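(* For every integer $m\ge0$ there exists a simple exact zero multiset $\Lambda_m$ for $\mathcal F^2$ such that $$\dim\mathcal I(\Lambda_m)=\infty,\qquad \iota(\Lambda_m)=m.$$ Explicitly, with $N=m+1$, one may take $$\Lambda_m=\mathcal L\setminus\bigl(\mathcal V\cup\{a_1,\dots,a_N\}\bigr),$$ where $\mathcal L=\sqrt\pi(\mathbb Z+i\mathbb Z)$, $\mathcal V=i\sqrt\pi\,\mathbb Z$, and $a_1,\dots,a_N$ are arbitrary distinct points of $\mathcal L\setminus\mathcal V$. In particular, $m=0$ yields an exact zero multiset that is maximal under finite additions and has an infinite-dimensional vanishing space.
   Context: $dA$ is planar Lebesgue measure. The Bargmann–Fock space $\mathcal F^2$ is the space of entire functions $f$ with $\|f\|_2^2:=\frac1\pi\int_{\mathbb C}|f(z)|^2e^{-|z|^2}\,dA(z)<\infty$. A multiset in $\mathbb C$ is a locally finite one with finite multiplicities, identified with its counting measure; it is simple if all multiplicities are one. For a nonzero entire $f$, $\mathcal Z(f)$ is its zero multiset. A multiset $\Lambda$ is an exact zero multiset if there is a nonzero $f\in\mathcal F^2$ with $\mathcal Z(f)=\Lambda$. The vanishing space is $\mathcal I(\Lambda)=\{f\in\mathcal F^2: f$ vanishes on $\Lambda$ with at least the prescribed multiplicities$\}$. For a finite multiset $\nu$, $|\nu|$ denotes its total multiplicity. For an exact zero multiset $\Lambda$, the exact insertion index is $$\iota(\Lambda)=\sup\{q\in\mathbb Z_{\ge0}:\Lambda+\nu\text{ is an exact zero multiset for every finite multiset }\nu\text{ with }|\nu|=q\},$$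 the value $+\infty$ being allowed. $\Lambda$ is maximal under finite additions if $\iota(\Lambda)=0$. *)

theory Defs
  imports
    "HOL-Complex_Analysis.Complex_Analysis"
    "HOL-Library.Function_Algebras"
    "HOL-Library.Multiset"
    "HOL-Library.Extended_Nat"
begin

definition fock_norm_sq :: "(complex \<Rightarrow> complex) \<Rightarrow> ennreal" where
  "fock_norm_sq f =
     ennreal (1 / pi) * (\<integral>\<^sup>+ z. ennreal ((norm (f z))\<^sup>2 * exp (- (norm z)\<^sup>2)) \<partial>lborel)"

definition fock :: "(complex \<Rightarrow> complex) set" where
  "fock = {f. f holomorphic_on UNIV \<and> fock_norm_sq f < \<infinity>}"

text \<open>
  A possibly infinite multiset in the plane is represented by its multiplicity function
  \<^typ>\<open>complex \<Rightarrow> nat\<close>, a set by its indicator. Local finiteness is automatic for exact zero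
  multisets, see \<open>exact_zero_mset_locally_finite\<close> below. Finite multisets are elements of
  \<^typ>\<open>complex multiset\<close>.
\<close>

definition locally_finite_mset :: "(complex \<Rightarrow> nat) \<Rightarrow> bool" where
  "locally_finite_mset \<Lambda> \<longleftrightarrow> (\<forall>K. compact K \<longrightarrow> finite {z \<in> K. \<Lambda> z > 0})"

definition simple_mset :: "(complex \<Rightarrow> nat) \<Rightarrow> bool" where
  "simple_mset \<Lambda> \<longleftrightarrow> (\<forall>z. \<Lambda> z \<le> 1)"

text \<open>Only meaningful for nonzero entire functions, for which \<^const>\<open>zorder\<close> is the order of
  vanishing at every point (and \<open>0\<close> where the function does not vanish).\<close>

definition zero_mset :: "(complex \<Rightarrow> complex) \<Rightarrow> complex \<Rightarrow> nat" where
  "zero_mset f z = nat (zorder f z)"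

definition exact_zero_mset :: "(complex \<Rightarrow> nat) \<Rightarrow> bool" where
  "exact_zero_mset \<Lambda> \<longleftrightarrow> (\<exists>f \<in> fock. f \<noteq> (\<lambda>_. 0) \<and> zero_mset f = \<Lambda>)"

definition vanishing_space :: "(complex \<Rightarrow> nat) \<Rightarrow> (complex \<Rightarrow> complex) set" where
  "vanishing_space \<Lambda> = {f \<in> fock. \<forall>z. \<forall>j < \<Lambda> z. (deriv ^^ j) f z = 0}"

definition insertion_index :: "(complex \<Rightarrow> nat) \<Rightarrow> enat" where
  "insertion_index \<Lambda> =
     Sup {enat q | q. \<forall>\<nu> :: complex multiset.
            size \<nu> = q \<longrightarrow> exact_zero_mset (\<lambda>z. \<Lambda> z + count \<nu> z)}"

definition maximal_under_finite_additions :: "(complex \<Rightarrow> nat) \<Rightarrow> bool" where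
  "maximal_under_finite_additions \<Lambda> \<longleftrightarrow> exact_zero_mset \<Lambda> \<and> insertion_index \<Lambda> = 0"

definition scale_fun :: "complex \<Rightarrow> (complex \<Rightarrow> complex) \<Rightarrow> complex \<Rightarrow> complex" where
  "scale_fun c f = (\<lambda>z. c * f z)"

global_interpretation cfun: vector_space scale_fun
  by unfold_locales (simp_all add: scale_fun_def fun_eq_iff algebra_simps)

text \<open>The dimension from the vector space locale is a natural number, which is \<open>0\<close> for
  infinite-dimensional subspaces.\<close>

definition cdimension :: "(complex \<Rightarrow> complex) set \<Rightarrow> enat" where
  "cdimension V =
     (if \<exists>B. finite B \<and> V \<subseteq> cfun.span B then enat (cfun.dim V) else \<infinity>)"

definition square_lattice :: "complex set" where
  "square_lattice =
     {of_real (sqrt pi) * (of_int m + \<i> * of_int n) | m n :: int. True}"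

definition vertical_line :: "complex set" where
  "vertical_line = {\<i> * of_real (sqrt pi) * of_int n | n :: int. True}"

lemma exact_zero_mset_locally_finite:
  assumes "exact_zero_mset \<Lambda>"
  shows "locally_finite_mset \<Lambda>"
proof -
  obtain f where f: "f holomorphic_on UNIV" "f \<noteq> (\<lambda>_. 0)" and \<Lambda>: "\<Lambda> = zero_mset f"
    using assms by (auto simp: exact_zero_mset_def fock_def)
  have zero: "f z = 0" if "\<Lambda> z > 0" for z
  proof (rule ccontr)
    assume "f z \<noteq> 0"
    moreover have "f analytic_on {z}"
      using f(1) by (meson analytic_on_holomorphic open_UNIV subset_UNIV)
    ultimately have "zorder f z = 0"
      by (intro zorder_eq_0I)
    then show False
      using that by (simp add: \<Lambda> zero_mset_def)
  qed
  have "finite {z \<in> K. \<Lambda> z > 0}" if "compact K" for K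
  proof -
    have "finite {z \<in> K. f z = 0}"
    proof (rule ccontr)
      assume inf: "infinite {z \<in> K. f z = 0}"
      then obtain x where "x \<in> K" and x: "x islimpt {z \<in> K. f z = 0}"
        using \<open>compact K\<close> compact_eq_Bolzano_Weierstrass
        by (metis (no_types, lifting) mem_Collect_eq subsetI)
      have "f w = 0" for w
        by (rule analytic_continuation[OF f(1) open_UNIV connected_UNIV _ _ x]) auto
      then show False using f(2) by auto
    qed
    then show ?thesis
      by (rule rev_finite_subset) (use zero in auto)
  qed
  then show ?thesis by (simp add: locally_finite_mset_def)
qed

end

theory Submission imports Defs "HOL-Probability.Sinc_Integral"
begin

text \<open>
  Write \<open>\<omega> = sqrt pi\<close>, \<open>x = Re z\<close>. Up to a constant, the Weierstrass sigma function of the lattice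
  \<open>\<omega> (Z + i Z)\<close> is
  \<open>exp (- z^2 / 2) * sinh (\<omega> z) * E (exp (2 \<omega> z)) * E (exp (- 2 \<omega> z))\<close>, where \<open>E\<close> is the entire
  function with simple zeros at \<open>exp (2 pi n)\<close>, \<open>n \<ge> 1\<close>. The lattice cell has area \<open>pi\<close>, and this makes
  the weighted modulus \<open>\<bar>sigma z\<bar> * exp (- \<bar>z\<bar>^2 / 2)\<close> doubly periodic. The factor
  \<open>sinh (\<omega> z)\<close> carries exactly the vertical line of zeros. Dropping it leaves the function
  \<^emph>\<open>slit sigma\<close>, whose weighted modulus is at most of order \<open>exp (- \<omega> \<bar>x\<bar>)\<close>,
  and of exactly this order away from the lattice: it decays exponentially away from the
  deleted line but only stays bounded along it. Square integrability is therefore decided on the line,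
  and it is decided by powers of \<open>\<bar>z\<bar>\<close>.

  Let \<open>\<Lambda>\<close> be the slit lattice without \<open>N\<close> further points and let \<open>\<nu>\<close> be a finite multiset of size
  \<open>q\<close>. The candidate function with zero multiset \<open>\<Lambda> + \<nu>\<close> is slit sigma times a rational factor
  of order \<open>\<bar>z\<bar>^(q - N)\<close>. For \<open>q < N\<close> its density is at most of order
  \<open>1 / ((1 + x^2) * (1 + y^2))\<close>, which is integrable (\<open>fock_member\<close>). The
  exponential decay in \<open>x\<close> also absorbs a factor \<open>exp (t z)\<close> with \<open>\<bar>t\<bar> \<le> 1\<close>, and these factors make the
  vanishing space infinite-dimensional.

  Conversely let \<open>q \<ge> N\<close>. Any entire function with the zero multiset \<open>\<Lambda> + \<nu>\<close> is the candidate times a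
  nonvanishing entire \<open>H\<close>. If the product is in Fock space, then its weighted modulus is bounded
  (\<open>fock_density_bounded\<close>). The lower bound for slit sigma on the grid of
  half-integer lines then gives \<open>\<bar>H z\<bar> \<le> C * exp (\<omega> \<bar>x\<bar>)\<close> there, and the maximum principle makes
  \<open>H\<close> of exponential type (\<open>half_grid_growth_imp_exponential_type\<close>). A nonvanishing
  function of exponential type is \<open>exp (\<alpha> + \<beta> z)\<close> by the inequality of Borel and Caratheodory, and it
  cannot decay both upwards and downwards along a vertical line. So in one of the two directions the
  weighted modulus of the product stays away from zero on a vertical sequence of grid points,
  although it has to tend to zero at infinity (\<open>fock_density_tendsto_0\<close>). Hence the insertion index
  is exactly \<open>N - 1\<close>.
\<close>

section \<open>Pointwise control of Bargmann--Fock functions\<close>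

lemma borel_measurable_Complex_pair [measurable]:
  "(\<lambda>(x, y). Complex x y) \<in> borel_measurable (lborel \<Otimes>\<^sub>M lborel)"
  by (simp add: Complex_eq)

lemma lborel_complex_eq_distr:
  "(lborel :: complex measure) = distr (lborel \<Otimes>\<^sub>M lborel) borel (\<lambda>(x, y). Complex x y)"
proof (rule lborel_eqI)
  fix l u :: complex
  assume "\<And>b. b \<in> Basis \<Longrightarrow> l \<bullet> b \<le> u \<bullet> b"
  from this[of 1] this[of \<i>] have le: "Re l \<le> Re u" "Im l \<le> Im u"
    by (auto simp: Basis_complex_def)
  have vim: "(\<lambda>(x, y). Complex x y) -` box l u = {Re l<..<Re u} \<times> {Im l<..<Im u}"
    by (auto simp: in_box_complex_iff)
  have "emeasure (distr (lborel \<Otimes>\<^sub>M lborel) borel (\<lambda>(x, y). Complex x y)) (box l u)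
      = emeasure (lborel \<Otimes>\<^sub>M lborel) ({Re l<..<Re u} \<times> {Im l<..<Im u})"
    by (subst emeasure_distr) (auto simp: vim space_pair_measure)
  also have "\<dots> = ennreal (Re u - Re l) * ennreal (Im u - Im l)"
    using le by (subst lborel.emeasure_pair_measure_Times) auto
  also have "\<dots> = (\<Prod>b\<in>Basis. (u - l) \<bullet> b)"
    using le by (simp add: Basis_complex_def ennreal_mult)
  finally show "emeasure (distr (lborel \<Otimes>\<^sub>M lborel) borel (\<lambda>(x, y). Complex x y)) (box l u)
      = (\<Prod>b\<in>Basis. (u - l) \<bullet> b)" .
qed simp

lemma nn_integral_complex:
  fixes f :: "complex \<Rightarrow> ennreal"
  assumes [measurable]: "f \<in> borel_measurable borel"
  shows "(\<integral>\<^sup>+ z. f z \<partial>lborel) = (\<integral>\<^sup>+ x. \<integral>\<^sup>+ y. f (Complex x y) \<partial>lborel \<partial>lborel)"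
    and "(\<integral>\<^sup>+ z. f z \<partial>lborel) = (\<integral>\<^sup>+ y. \<integral>\<^sup>+ x. f (Complex x y) \<partial>lborel \<partial>lborel)"
proof -
  have [measurable]: "(\<lambda>p. f (Complex (fst p) (snd p))) \<in> borel_measurable (lborel \<Otimes>\<^sub>M lborel)"
    using measurable_compose[OF borel_measurable_Complex_pair assms]
    by (simp add: case_prod_beta')
  have *: "(\<integral>\<^sup>+ z. f z \<partial>lborel) = (\<integral>\<^sup>+ p. f (Complex (fst p) (snd p)) \<partial>(lborel \<Otimes>\<^sub>M lborel))"
    by (subst lborel_complex_eq_distr, subst nn_integral_distr) (simp_all add: case_prod_beta')
  show "(\<integral>\<^sup>+ z. f z \<partial>lborel) = (\<integral>\<^sup>+ x. \<integral>\<^sup>+ y. f (Complex x y) \<partial>lborel \<partial>lborel)"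
    unfolding * using lborel.nn_integral_fst[of "\<lambda>p. f (Complex (fst p) (snd p))" lborel] by simp
  show "(\<integral>\<^sup>+ z. f z \<partial>lborel) = (\<integral>\<^sup>+ y. \<integral>\<^sup>+ x. f (Complex x y) \<partial>lborel \<partial>lborel)"
    unfolding * using lborel_pair.nn_integral_snd[of "\<lambda>p. f (Complex (fst p) (snd p))"] by simp
qed

lemma contour_integral_linepath_direction:
  assumes "a < b"
  shows "contour_integral (linepath (p + of_real a * u) (p + of_real b * u)) f =
         u * integral {a..b} (\<lambda>t. f (p + of_real t * u))"
proof -
  let ?z = "p + of_real a * u" and ?w = "p + of_real b * u"
  have "contour_integral (linepath ?z ?w) f = (?w - ?z) * integral {0..1} (\<lambda>x. f (linepath ?z ?w x))"
    by (simp add: contour_integral_integral)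
  also have "(\<lambda>x. f (linepath ?z ?w x)) = (\<lambda>x. f (p + of_real ((b - a) * x + a) * u))"
    by (auto simp: linepath_def fun_eq_iff scaleR_conv_of_real algebra_simps)
  also have "{0..1} = (\<lambda>x. x / (b - a)) ` {0..b - a}"
    using assms by simp
  also have "integral \<dots> (\<lambda>x. f (p + of_real ((b - a) * x + a) * u))
      = integral {a - a..b - a} (\<lambda>x. f (p + of_real (x + a) * u)) / of_real (b - a)"
    using assms by (subst integral_stretch_real) (auto simp: scaleR_conv_of_real)
  also have "\<dots> = integral {a..b} (\<lambda>t. f (p + of_real t * u)) / of_real (b - a)"
    by (subst integral_shift_real_ivl) (rule refl)
  also have "?w - ?z = of_real (b - a) * u"
    by (simp add: algebra_simps)
  finally show ?thesis
    using assms by simp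
qed

text \<open>
  One side of the rectangle in Cauchy's formula at the origin. The side stays at distance at least
  one from the origin, so the Cauchy kernel can be dropped. The bound uses a longer segment that
  does not depend on the rectangle, which prepares the averaging over rectangles below.
\<close>

lemma norm_contour_integral_linepath_le:
  assumes cont: "continuous_on UNIV g" and [simp]: "norm u = 1" and ab: "-2 \<le> a" "a < b" "b \<le> 2"
    and far: "\<And>t. norm (p + of_real t * u) \<ge> 1"
  shows "ennreal (norm (contour_integral (linepath (p + of_real a * u) (p + of_real b * u))
            (\<lambda>w. g w / (w - 0))))
     \<le> (\<integral>\<^sup>+ t. ennreal (norm (g (p + of_real t * u))) * indicator {-2..2} t \<partial>lborel)"
proof -
  have nz: "p + of_real t * u \<noteq> 0" for t using far[of t] by auto
  have c: "continuous_on A (\<lambda>t. g (p + of_real t * u))" for A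
    by (rule continuous_on_compose2[OF cont]) (auto intro!: continuous_intros)
  let ?h = "\<lambda>t. g (p + of_real t * u) / (p + of_real t * u)"
  have c': "continuous_on A ?h" for A
    using nz by (intro continuous_intros c) auto
  have "norm (contour_integral (linepath (p + of_real a * u) (p + of_real b * u)) (\<lambda>w. g w / (w - 0)))
      = norm (integral {a..b} ?h)"
    using ab by (simp add: contour_integral_linepath_direction norm_mult)
  also have "\<dots> \<le> integral {a..b} (\<lambda>t. norm (g (p + of_real t * u)))"
  proof (rule integral_norm_bound_integral)
    show "norm (?h t) \<le> norm (g (p + of_real t * u))" for t
      using far[of t] nz[of t] by (simp add: norm_divide divide_simps mult_left_mono mult_le_cancel_left1)
  qed (auto intro!: integrable_continuous_real c c' continuous_intros)
  finally have "ennreal (norm (contour_integral (linepath (p + of_real a * u) (p + of_real b * u))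
            (\<lambda>w. g w / (w - 0)))) \<le> ennreal (integral {a..b} (\<lambda>t. norm (g (p + of_real t * u))))"
    by (rule ennreal_leI)
  also have "\<dots> = (\<integral>\<^sup>+ t. ennreal (norm (g (p + of_real t * u))) * indicator {a..b} t \<partial>lborel)"
    by (rule nn_integral_has_integral_lebesgue' [symmetric])
       (auto intro!: integrable_integral integrable_continuous_real c continuous_intros)
  also have "\<dots> \<le> (\<integral>\<^sup>+ t. ennreal (norm (g (p + of_real t * u))) * indicator {-2..2} t \<partial>lborel)"
    using ab by (intro nn_integral_mono) (auto simp: indicator_def)
  finally show ?thesis .
qed

text \<open>
  Each of the four terms depends on the position of one side only, so that the four
  positions can be averaged independently of each other.
\<close>

lemma norm_le_rectangle_sides:
  assumes g: "g holomorphic_on UNIV"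
    and x: "x1 \<in> {-2..-1}" "x2 \<in> {1..2}" and y: "y1 \<in> {-2..-1}" "y2 \<in> {1..2}"
  defines "V \<equiv> \<lambda>x. \<integral>\<^sup>+ t. ennreal (norm (g (Complex x t))) * indicator {-2..2} t \<partial>lborel"
    and "W \<equiv> \<lambda>y. \<integral>\<^sup>+ t. ennreal (norm (g (Complex t y))) * indicator {-2..2} t \<partial>lborel"
  shows "ennreal (norm (g 0)) \<le> V x1 + (V x2 + (W y1 + W y2))"
proof -
  define F where "F = (\<lambda>w. g w / (w - 0))"
  let ?a = "Complex x1 y1" and ?b = "Complex x2 y1" and ?c = "Complex x2 y2" and ?d = "Complex x1 y2"
  let ?I = "\<lambda>z w. contour_integral (linepath z w) F"
  have cg: "continuous_on UNIV g" by (rule holomorphic_on_imp_continuous_on[OF g])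
  have vert: "ennreal (norm (?I (Complex x y1) (Complex x y2))) \<le> V x" if "\<bar>x\<bar> \<ge> 1" for x
  proof -
    have "norm (of_real x + of_real t * \<i>) \<ge> 1" for t
      using abs_Re_le_cmod[of "of_real x + of_real t * \<i>"] that by simp
    from norm_contour_integral_linepath_le[OF cg _ _ _ _ this, of y1 y2] y
    show ?thesis by (simp add: V_def F_def Complex_eq mult.commute)
  qed
  have hor: "ennreal (norm (?I (Complex x1 y) (Complex x2 y))) \<le> W y" if "\<bar>y\<bar> \<ge> 1" for y
  proof -
    have "norm (\<i> * of_real y + of_real t * 1) \<ge> 1" for t
      using abs_Im_le_cmod[of "\<i> * of_real y + of_real t * 1"] that by simp
    from norm_contour_integral_linepath_le[OF cg _ _ _ _ this, of x1 x2] x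
    show ?thesis by (simp add: W_def F_def Complex_eq add.commute)
  qed
  have image: "path_image (rectpath ?a ?c) \<subseteq> UNIV - {0}"
    using x y by (subst path_image_rectpath) auto
  have "(F has_contour_integral (2*pi * \<i> * winding_number (rectpath ?a ?c) 0 * g 0)) (rectpath ?a ?c)"
    unfolding F_def by (rule Cauchy_integral_formula_convex_simple[of UNIV])
      (use g image in auto)
  also have "winding_number (rectpath ?a ?c) 0 = 1"
    using x y by (intro winding_number_rectpath) (auto simp: in_box_complex_iff)
  finally have ci: "(F has_contour_integral (2*pi * \<i> * g 0)) (rectpath ?a ?c)" by simp
  have seg: "F contour_integrable_on linepath z w" if "0 \<notin> closed_segment z w" for z w
    unfolding F_def using that by (intro contour_integrable_continuous_linepath continuous_intros
        continuous_on_subset[OF cg]) auto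
  have s: "0 \<notin> closed_segment ?a ?b" "0 \<notin> closed_segment ?b ?c" "0 \<notin> closed_segment ?c ?d" 
    "0 \<notin> closed_segment ?d ?a"
    using x y by (auto simp: closed_segment_same_Re closed_segment_same_Im)
  have tri: "norm (A + (B + (- C - D))) \<le> norm A + (norm B + (norm C + norm D))" for A B C D :: complex
    using norm_triangle_ineq[of A "B + (- C - D)"] norm_triangle_ineq[of B "- C - D"]
      norm_triangle_ineq4[of "- C" D] by simp
  have "2*pi * \<i> * g 0 = contour_integral (rectpath ?a ?c) F"
    using ci by (simp add: contour_integral_unique)
  also have "\<dots> = ?I ?a ?b + (?I ?b ?c + (?I ?c ?d + ?I ?d ?a))"
    using s by (simp add: rectpath_def Let_def seg contour_integrable_joinI)
  also have "\<dots> = ?I ?a ?b + (?I ?b ?c + (- ?I ?d ?c - ?I ?a ?d))"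
  proof -
    have rev: "?I w z = - ?I z w" if "0 \<notin> closed_segment w z" for z w
      by (rule contour_integral_reverse_linepath)
         (use that in \<open>auto simp: F_def intro!: continuous_intros continuous_on_subset[OF cg]\<close>)
    show ?thesis using rev[OF s(3)] rev[OF s(4)] by simp
  qed
  finally have "norm (2*pi * \<i> * g 0) \<le> norm (?I ?a ?b) + (norm (?I ?b ?c) + (norm (?I ?d ?c) + norm (?I ?a ?d)))"
    using tri by metis
  moreover have "norm (g 0) \<le> norm (2*pi * \<i> * g 0)"
    using pi_gt3 by (simp add: norm_mult mult_le_cancel_right1)
  ultimately have "norm (g 0) \<le> norm (?I ?a ?d) + (norm (?I ?b ?c) + (norm (?I ?a ?b) + norm (?I ?d ?c)))"
    by linarith
  then have "ennreal (norm (g 0)) \<le> ennreal (norm (?I ?a ?d)) + (ennreal (norm (?I ?b ?c)) + 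
      (ennreal (norm (?I ?a ?b)) + ennreal (norm (?I ?d ?c))))"
    by (simp flip: ennreal_plus add: ennreal_leI)
  also have "\<dots> \<le> V x1 + (V x2 + (W y1 + W y2))"
    using x y by (intro add_mono vert hor) auto
  finally show ?thesis .
qed

lemma le_unit_interval_average:
  fixes L :: "real \<Rightarrow> ennreal"
  assumes [measurable]: "L \<in> borel_measurable borel"
    and le: "\<And>x. x \<in> {a..a + 1} \<Longrightarrow> c \<le> L x + d"
  shows "c \<le> (\<integral>\<^sup>+ x. L x * indicator {a..a + 1} x \<partial>lborel) + d"
proof -
  have "c = (\<integral>\<^sup>+ x. c * indicator {a..a + 1} x \<partial>lborel)"
    by (subst nn_integral_cmult_indicator) auto
  also have "\<dots> \<le> (\<integral>\<^sup>+ x. (L x * indicator {a..a + 1} x + d * indicator {a..a + 1} x) \<partial>lborel)"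
    using le by (intro nn_integral_mono) (auto simp: indicator_def)
  also have "\<dots> = (\<integral>\<^sup>+ x. L x * indicator {a..a + 1} x \<partial>lborel) + d"
    by (subst nn_integral_add) (auto simp: nn_integral_cmult_indicator)
  finally show ?thesis .
qed

abbreviation centred_square :: "complex set" where
  "centred_square \<equiv> cbox (Complex (-2) (-2)) (Complex 2 2)"

text \<open>
  This is a crude substitute for the area mean value inequality. Averaging the Cauchy estimate over
  the positions of the four sides turns each line integral into an integral over a part of the square.
\<close>

lemma norm_le_area_integral:
  assumes g: "g holomorphic_on UNIV"
  shows "ennreal (norm (g 0)) \<le> 4 * (\<integral>\<^sup>+ w. ennreal (norm (g w)) * indicator centred_square w \<partial>lborel)"
proof -
  define V where "V = (\<lambda>x. \<integral>\<^sup>+ t. ennreal (norm (g (Complex x t))) * indicator {-2..2} t \<partial>lborel)"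
  define W where "W = (\<lambda>y. \<integral>\<^sup>+ t. ennreal (norm (g (Complex t y))) * indicator {-2..2} t \<partial>lborel)"
  define I where "I = (\<integral>\<^sup>+ w. ennreal (norm (g w)) * indicator centred_square w \<partial>lborel)"
  have [measurable]: "g \<in> borel_measurable borel"
    using holomorphic_on_imp_continuous_on[OF g] by (rule borel_measurable_continuous_onI)
  have m [measurable]: "(\<lambda>p. g (Complex (fst p) (snd p))) \<in> borel_measurable (lborel \<Otimes>\<^sub>M lborel)"
    using measurable_compose[OF borel_measurable_Complex_pair \<open>g \<in> borel_measurable borel\<close>]
    by (simp add: case_prod_beta')
  have m' [measurable]: "(\<lambda>p. g (Complex (snd p) (fst p))) \<in> borel_measurable (lborel \<Otimes>\<^sub>M lborel)"
    using measurable_compose[OF measurable_pair_swap' m] by (simp add: case_prod_beta')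
  have [measurable]: "V \<in> borel_measurable borel" "W \<in> borel_measurable borel"
    unfolding V_def W_def using m m'
    by (auto intro!: lborel.borel_measurable_nn_integral simp: case_prod_beta')
  have IV: "(\<integral>\<^sup>+ x. V x * indicator {a..a + 1} x \<partial>lborel) \<le> I" if "-2 \<le> a" "a \<le> 1" for a
  proof -
    have "(\<integral>\<^sup>+ x. V x * indicator {a..a + 1} x \<partial>lborel) 
       \<le> (\<integral>\<^sup>+ x. V x * indicator {-2..2} x \<partial>lborel)"
      using that by (intro nn_integral_mono) (auto simp: indicator_def)
    also have "\<dots> = I"
      unfolding V_def I_def
      by (subst nn_integral_complex(1))
         (auto simp flip: nn_integral_multc intro!: nn_integral_cong
            simp: indicator_def in_cbox_complex_iff)
    finally show ?thesis .
  qed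
  have IW: "(\<integral>\<^sup>+ x. W x * indicator {a..a + 1} x \<partial>lborel) \<le> I" if "-2 \<le> a" "a \<le> 1" for a
  proof -
    have "(\<integral>\<^sup>+ x. W x * indicator {a..a + 1} x \<partial>lborel) 
       \<le> (\<integral>\<^sup>+ x. W x * indicator {-2..2} x \<partial>lborel)"
      using that by (intro nn_integral_mono) (auto simp: indicator_def)
    also have "\<dots> = I"
      unfolding W_def I_def
      by (subst nn_integral_complex(2))
         (auto simp flip: nn_integral_multc intro!: nn_integral_cong
            simp: indicator_def in_cbox_complex_iff)
    finally show ?thesis .
  qed
  let ?A = "\<lambda>L a. \<integral>\<^sup>+ x. L x * indicator {a..a + 1::real} x \<partial>lborel"
  have "ennreal (norm (g 0)) \<le> V x1 + (V x2 + (W y1 + W y2))"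
    if "x1 \<in> {-2..-1}" "x2 \<in> {1..2}" "y1 \<in> {-2..-1}" "y2 \<in> {1..2}" for x1 x2 y1 y2
    unfolding V_def W_def by (rule norm_le_rectangle_sides[OF g that])
  then have "ennreal (norm (g 0)) \<le> ?A V (-2) + (V x2 + (W y1 + W y2))"
    if "x2 \<in> {1..2}" "y1 \<in> {-2..-1}" "y2 \<in> {1..2}" for x2 y1 y2
    using that by (intro le_unit_interval_average) auto
  then have "ennreal (norm (g 0)) \<le> ?A V 1 + (?A V (-2) + (W y1 + W y2))"
    if "y1 \<in> {-2..-1}" "y2 \<in> {1..2}" for y1 y2
    using that by (intro le_unit_interval_average) (auto simp: ac_simps)
  then have "ennreal (norm (g 0)) \<le> ?A W (-2) + (?A V 1 + (?A V (-2) + W y2))"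
    if "y2 \<in> {1..2}" for y2
    using that by (intro le_unit_interval_average) (auto simp: ac_simps)
  then have "ennreal (norm (g 0)) \<le> ?A W 1 + (?A W (-2) + (?A V 1 + ?A V (-2)))"
    by (intro le_unit_interval_average) (auto simp: ac_simps)
  also have "\<dots> \<le> I + (I + (I + I))"
    by (intro add_mono IV IW) auto
  also have "\<dots> = 4 * I"
  proof -
    have "(4 :: ennreal) = 1 + (1 + (1 + 1))" by simp
    then show ?thesis by (simp only: distrib_right mult_1)
  qed
  finally show ?thesis by (simp add: I_def)
qed

definition fock_density :: "(complex \<Rightarrow> complex) \<Rightarrow> complex \<Rightarrow> real" where
  "fock_density f z = (norm (f z))\<^sup>2 * exp (- (norm z)\<^sup>2)"

lemma fock_density_nonneg [simp]: "0 \<le> fock_density f z"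
  by (simp add: fock_density_def)

lemma fock_density_measurable [measurable]:
  assumes "f holomorphic_on UNIV"
  shows "fock_density f \<in> borel_measurable borel"
proof -
  have [measurable]: "f \<in> borel_measurable borel"
    using holomorphic_on_imp_continuous_on[OF assms] by (rule borel_measurable_continuous_onI)
  show ?thesis unfolding fock_density_def by measurable
qed

lemma fock_iff_density:
  "f \<in> fock \<longleftrightarrow> f holomorphic_on UNIV \<and> (\<integral>\<^sup>+ z. ennreal (fock_density f z) \<partial>lborel) < \<infinity>"
proof -
  have "ennreal (1 / pi) \<noteq> 0" "ennreal (1 / pi) < \<infinity>" by auto
  then show ?thesis
    unfolding fock_def fock_norm_sq_def fock_density_def
    by (auto simp: ennreal_mult_less_top)
qed

abbreviation square_around :: "complex \<Rightarrow> complex set" where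
  "square_around z \<equiv> cbox (z - Complex 2 2) (z + Complex 2 2)"

text \<open>
  The Gaussian weight is not holomorphic, but
  \<open>fock_density f (z + u) = \<bar>f (z + u) * exp (- u * cnj z)\<bar>^2 * exp (- \<bar>z\<bar>^2) * exp (- \<bar>u\<bar>^2)\<close>.
  The first factor is the modulus of a holomorphic function of \<open>u\<close>, to which the area estimate applies
  directly because of the square, and the last factor is bounded below near \<open>u = 0\<close>.
\<close>

lemma fock_density_le_local_integral:
  assumes f: "f holomorphic_on UNIV"
  shows "ennreal (fock_density f z) \<le> ennreal (4 * exp 8) *
     (\<integral>\<^sup>+ w. ennreal (fock_density f w) * indicator (square_around z) w \<partial>lborel)"
proof -
  note [measurable] = fock_density_measurable[OF f]
  define g where "g = (\<lambda>u. (f (z + u) * exp (- (u * cnj z)))\<^sup>2)"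
  have g: "g holomorphic_on UNIV"
    unfolding g_def
    by (intro holomorphic_intros holomorphic_on_compose_gen[OF _ f, unfolded o_def]) auto
  have norm_g: "norm (g u) = fock_density f (z + u) * exp ((norm z)\<^sup>2) * exp ((norm u)\<^sup>2)" for u
  proof -
    have "(norm (z + u))\<^sup>2 = (norm z)\<^sup>2 + (norm u)\<^sup>2 + 2 * Re (u * cnj z)"
      by (simp only: cmod_power2) (simp add: power2_eq_square algebra_simps)
    then have "exp (- (norm (z + u))\<^sup>2) * exp ((norm z)\<^sup>2) * exp ((norm u)\<^sup>2) = exp (- (2 * Re (u * cnj z)))"
      by (simp flip: exp_add)
    also have "\<dots> = (exp (- Re (u * cnj z)))\<^sup>2"
      by (simp flip: exp_double)
    finally show ?thesis
      by (simp add: g_def fock_density_def norm_power norm_mult power_mult_distrib mult.assoc)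
  qed
  have "ennreal (fock_density f z * exp ((norm z)\<^sup>2)) = ennreal (norm (g 0))"
    by (simp add: norm_g)
  also have "\<dots> \<le> 4 * (\<integral>\<^sup>+ u. ennreal (norm (g u)) * indicator centred_square u \<partial>lborel)"
    by (rule norm_le_area_integral[OF g])
  also have "\<dots> \<le> 4 * (\<integral>\<^sup>+ u. ennreal (exp 8 * exp ((norm z)\<^sup>2)) * (ennreal (fock_density f (z + u))
        * indicator (square_around z) (z + u)) \<partial>lborel)"
  proof (intro mult_left_mono nn_integral_mono)
    fix u :: complex
    show "ennreal (norm (g u)) * indicator centred_square u
       \<le> ennreal (exp 8 * exp ((norm z)\<^sup>2)) * (ennreal (fock_density f (z + u))
        * indicator (square_around z) (z + u))"
    proof (cases "u \<in> centred_square")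
      case True
      then have "\<bar>Re u\<bar> \<le> 2" "\<bar>Im u\<bar> \<le> 2" and in2: "z + u \<in> square_around z"
        by (auto simp: in_cbox_complex_iff)
      then have "(Re u)\<^sup>2 \<le> 2\<^sup>2" "(Im u)\<^sup>2 \<le> 2\<^sup>2"
        using abs_le_square_iff[of "Re u" 2] abs_le_square_iff[of "Im u" 2] by simp_all
      then have "(norm u)\<^sup>2 \<le> 8" by (simp add: cmod_power2)
      then have "norm (g u) \<le> (exp 8 * exp ((norm z)\<^sup>2)) * fock_density f (z + u)"
        unfolding norm_g by (simp add: mult_left_mono mult_ac)
      then show ?thesis using True in2
        by (simp add: ennreal_leI flip: ennreal_mult)
    qed auto
  qed auto
  also have "\<dots> = 4 * (ennreal (exp 8 * exp ((norm z)\<^sup>2)) * (\<integral>\<^sup>+ u. (ennreal (fock_density f (z + u))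
        * indicator (square_around z) (z + u)) \<partial>lborel))"
    by (subst nn_integral_cmult) auto
  also have "(\<integral>\<^sup>+ u. (ennreal (fock_density f (z + u)) * indicator (square_around z) (z + u)) \<partial>lborel)
     = (\<integral>\<^sup>+ w. ennreal (fock_density f w) * indicator (square_around z) w \<partial>lborel)"
    by (subst (2) lborel_distr_plus [symmetric, of z], subst nn_integral_distr) auto
  finally have "ennreal (exp (- (norm z)\<^sup>2)) * ennreal (fock_density f z * exp ((norm z)\<^sup>2))
      \<le> ennreal (exp (- (norm z)\<^sup>2)) * (4 * (ennreal (exp 8 * exp ((norm z)\<^sup>2)) *
       (\<integral>\<^sup>+ w. ennreal (fock_density f w) * indicator (square_around z) w \<partial>lborel)))"
    by (rule mult_left_mono) simp
  also have "ennreal (exp (- (norm z)\<^sup>2)) * ennreal (fock_density f z * exp ((norm z)\<^sup>2)) 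
      = ennreal (fock_density f z)"
    by (simp flip: ennreal_mult) (simp add: exp_minus)
  also have "ennreal (exp (- (norm z)\<^sup>2)) * (4 * (ennreal (exp 8 * exp ((norm z)\<^sup>2)) *
       (\<integral>\<^sup>+ w. ennreal (fock_density f w) * indicator (square_around z) w \<partial>lborel)))
     = (ennreal (exp (- (norm z)\<^sup>2)) * (ennreal 4 * ennreal (exp 8 * exp ((norm z)\<^sup>2)))) *
       (\<integral>\<^sup>+ w. ennreal (fock_density f w) * indicator (square_around z) w \<partial>lborel)"
    by (simp only: mult.assoc) simp
  also have "ennreal (exp (- (norm z)\<^sup>2)) * (ennreal 4 * ennreal (exp 8 * exp ((norm z)\<^sup>2))) = ennreal (4 * exp 8)"
    by (subst ennreal_mult [symmetric], simp, simp, subst ennreal_mult [symmetric]) (auto simp: exp_minus)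
  finally show ?thesis .
qed

lemma fock_density_bounded:
  assumes "f \<in> fock"
  obtains C where "C \<ge> 0" "\<And>z. fock_density f z \<le> C"
proof -
  have f: "f holomorphic_on UNIV" and fin: "(\<integral>\<^sup>+ z. ennreal (fock_density f z) \<partial>lborel) < \<infinity>"
    using assms by (auto simp: fock_iff_density)
  define C where "C = ennreal (4 * exp 8) * (\<integral>\<^sup>+ z. ennreal (fock_density f z) \<partial>lborel)"
  have "C < \<infinity>" unfolding C_def using fin by (simp add: ennreal_mult_less_top)
  have le: "ennreal (fock_density f z) \<le> C" for z
  proof -
    have "(\<integral>\<^sup>+ w. ennreal (fock_density f w) * indicator (square_around z) w \<partial>lborel)
        \<le> (\<integral>\<^sup>+ w. ennreal (fock_density f w) \<partial>lborel)"
      by (intro nn_integral_mono) (auto simp: indicator_def)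
    then show ?thesis
      unfolding C_def
      by (intro order_trans[OF fock_density_le_local_integral[OF f]] mult_left_mono) auto
  qed
  show ?thesis
  proof
    show "0 \<le> enn2real C" by simp
    show "fock_density f z \<le> enn2real C" for z
      using enn2real_mono[OF le[of z]] \<open>C < \<infinity>\<close> by simp
  qed
qed

lemma fock_density_tendsto_0:
  assumes "f \<in> fock" and z: "filterlim z at_infinity sequentially"
  shows "(\<lambda>n. fock_density f (z n)) \<longlonglongrightarrow> 0"
proof -
  have f: "f holomorphic_on UNIV" and fin: "(\<integral>\<^sup>+ z. ennreal (fock_density f z) \<partial>lborel) < \<infinity>"
    using assms by (auto simp: fock_iff_density)
  note [measurable] = fock_density_measurable[OF f]
  let ?I = "\<lambda>n. \<integral>\<^sup>+ w. ennreal (fock_density f w) * indicator (square_around (z n)) w \<partial>lborel"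
  \<comment> \<open>The squares around \<open>z n\<close> leave every bounded set, so dominated convergence applies.\<close>
  have "?I \<longlonglongrightarrow> (\<integral>\<^sup>+ (w::complex). 0 \<partial>lborel)"
  proof (rule nn_integral_dominated_convergence[where w = "\<lambda>w. ennreal (fock_density f w)"])
    show "AE w in lborel. (\<lambda>n. ennreal (fock_density f w) * indicator (square_around (z n)) w) \<longlonglongrightarrow> 0"
    proof (rule AE_I2)
      fix w :: complex
      have "\<forall>\<^sub>F n in sequentially. norm (z n) \<ge> norm w + 5"
        using z norm_ge_zero[of w]
        unfolding filterlim_at_infinity[OF order.refl] by (metis add_nonneg_pos zero_less_numeral)
      then have "\<forall>\<^sub>F n in sequentially. 
          ennreal (fock_density f w) * indicator (square_around (z n)) w = 0"
      proof eventually_elim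
        case (elim n)
        have "w \<notin> square_around (z n)"
        proof
          assume "w \<in> square_around (z n)"
          then have "\<bar>Re (z n - w)\<bar> \<le> 2" "\<bar>Im (z n - w)\<bar> \<le> 2" 
            by (auto simp: in_cbox_complex_iff)
          then have "norm (z n - w) \<le> 4"
            using cmod_le[of "z n - w"] by linarith
          then show False using elim norm_triangle_ineq2[of "z n" w] by linarith
        qed
        then show ?case by simp
      qed
      then show "(\<lambda>n. ennreal (fock_density f w) * indicator (square_around (z n)) w) \<longlonglongrightarrow> 0"
        by (rule tendsto_eventually)
    qed
  qed (use fin in \<open>auto simp: indicator_def\<close>)
  then have "(\<lambda>n. ennreal (4 * exp 8) * ?I n) \<longlonglongrightarrow> ennreal (4 * exp 8) * 0"
    by (intro ennreal_tendsto_cmult) auto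
  then have lim: "(\<lambda>n. ennreal (4 * exp 8) * ?I n) \<longlonglongrightarrow> 0" by simp
  have "(\<lambda>n. ennreal (fock_density f (z n))) \<longlonglongrightarrow> 0"
  proof (rule tendsto_sandwich[OF _ _ tendsto_const lim])
    show "\<forall>\<^sub>F n in sequentially. ennreal (fock_density f (z n)) \<le> ennreal (4 * exp 8) * ?I n"
      by (rule always_eventually, rule allI, rule fock_density_le_local_integral[OF f])
  qed simp
  then have "(\<lambda>n. ennreal (fock_density f (z n))) \<longlonglongrightarrow> ennreal 0" by simp
  then show ?thesis
    by (subst (asm) tendsto_ennreal_iff) auto
qed

lemma fockI_density_bound:
  assumes f: "f holomorphic_on UNIV" 
    and le: "\<And>z. fock_density f z \<le> C / ((1 + (Re z)\<^sup>2) * (1 + (Im z)\<^sup>2))"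
  shows "f \<in> fock"
proof -
  have C: "C \<ge> 0"
    using order_trans[OF fock_density_nonneg le[of 0]] by simp
  have fin: "(\<integral>\<^sup>+ x. ennreal (inverse (1 + x\<^sup>2)) \<partial>lborel) < \<infinity>"
    using integrable_inverse_1_plus_square
    by (simp add: set_integrable_def integrable_iff_bounded abs_inverse)
  have "(\<integral>\<^sup>+ z. ennreal (fock_density f z) \<partial>lborel)
     \<le> (\<integral>\<^sup>+ (z::complex). ennreal C * (\<Prod>b\<in>Basis. ennreal (inverse (1 + (z \<bullet> b)\<^sup>2))) \<partial>lborel)"
  proof (rule nn_integral_mono)
    fix z :: complex
    have "fock_density f z \<le> C * (inverse (1 + (Re z)\<^sup>2) * inverse (1 + (Im z)\<^sup>2))"
      using le[of z] by (simp add: divide_inverse)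
    then show "ennreal (fock_density f z) \<le> ennreal C * (\<Prod>b\<in>Basis. ennreal (inverse (1 + (z \<bullet> b)\<^sup>2)))"
      using C by (simp add: Basis_complex_def ennreal_leI flip: ennreal_mult)
  qed
  also have "\<dots> = ennreal C * (\<Prod>b\<in>(Basis::complex set). \<integral>\<^sup>+ x. ennreal (inverse (1 + x\<^sup>2)) \<partial>lborel)"
    by (subst nn_integral_cmult, measurable, subst nn_integral_lborel_prod) auto
  also have "\<dots> < \<infinity>"
    using fin by (simp add: Basis_complex_def ennreal_mult_less_top)
  finally show ?thesis
    using f by (simp add: fock_iff_density)
qed

section \<open>The sigma function of the square lattice as a theta product\<close>

definition euler_product :: "complex \<Rightarrow> complex" where
  "euler_product u = (\<Prod>n. 1 - u / of_real (exp (2 * pi * (real n + 1))))"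

text \<open>
  The product is a Weierstrass product of genus zero, whose general theory yields its zeros and
  their orders.
\<close>

interpretation euler: weierstrass_product "\<lambda>n. of_real (exp (2 * pi * (real n + 1)))" "\<lambda>_. 0"
  rewrites "weierstrass_product.f (\<lambda>n. of_real (exp (2 * pi * (real n + 1)))) (\<lambda>_. 0) = euler_product"
proof -
  show *: "weierstrass_product (\<lambda>n. of_real (exp (2 * pi * (real n + 1)))) (\<lambda>_. 0)"
  proof
    show "filterlim (\<lambda>n. complex_of_real (exp (2 * pi * (real n + 1)))) at_infinity sequentially"
    proof (rule filterlim_norm_at_top_imp_at_infinity)
      have "filterlim (\<lambda>n. 2 * pi * (real n + 1)) at_top sequentially"
        by real_asymp
      then show "filterlim (\<lambda>n. norm (complex_of_real (exp (2 * pi * (real n + 1))))) at_top sequentially"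
        by (simp add: filterlim_compose[OF exp_at_top])
    qed
    fix r :: real assume "r > 0"
    have "summable (\<lambda>n. r * exp (- 2 * pi) * exp (- 2 * pi) ^ n)"
      by (intro summable_mult summable_geometric) simp
    moreover have "(r / norm (complex_of_real (exp (2 * pi * (real n + 1))))) ^ Suc 0
        = r * exp (- 2 * pi) * exp (- 2 * pi) ^ n" for n
    proof -
      have "exp (- 2 * pi) * exp (- 2 * pi) ^ n = exp (- (2 * pi * (real n + 1)))"
        unfolding exp_of_nat_mult [symmetric] exp_add [symmetric] by (simp add: algebra_simps)
      then show ?thesis by (simp add: exp_minus divide_inverse mult.assoc)
    qed
    ultimately show "summable (\<lambda>n. (r / norm (complex_of_real (exp (2 * pi * (real n + 1))))) ^ Suc 0)"
      by presburger
  qed simp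
  show "weierstrass_product.f (\<lambda>n. of_real (exp (2 * pi * (real n + 1)))) (\<lambda>_. 0) = euler_product"
    by (rule ext) (simp add: weierstrass_product.f_def[OF *] euler_product_def weierstrass_factor_def)
qed

lemma euler_product_eq_0_iff: "euler_product u = 0 \<longleftrightarrow> (\<exists>n. u = of_real (exp (2 * pi * (real n + 1))))"
  using euler.zero by auto

lemma euler_product_1_nonzero: "euler_product 1 \<noteq> 0"
proof
  assume "euler_product 1 = 0"
  then obtain n where "1 = complex_of_real (exp (2 * pi * (real n + 1)))" 
    unfolding euler_product_eq_0_iff by auto
  then have "1 = exp (2 * pi * (real n + 1))" by (metis of_real_1 of_real_eq_iff)
  moreover have "2 * pi * (real n + 1) > 0" by (simp add: add_nonneg_pos)
  ultimately show False by (metis exp_eq_one_iff less_irrefl)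
qed

lemma zorder_euler_product:
  assumes "euler_product u = 0"
  shows "zorder euler_product u = 1"
proof -
  obtain n where u: "u = of_real (exp (2 * pi * (real n + 1)))"
    using assms by (auto simp: euler_product_eq_0_iff)
  have "(\<lambda>n. complex_of_real (exp (2 * pi * (real n + 1)))) -` {u} = {n}"
    by (auto simp: u)
  then show ?thesis by (simp add: euler.zorder)
qed

text \<open>
  Replacing \<open>u\<close> by \<open>exp (2 pi) * u\<close> shifts the index of the product by one and adds the factor
  \<open>1 - u\<close>. This is the source of the quasi-periodicity of the sigma function in the real direction.
\<close>

lemma euler_product_shift: "euler_product (u * of_real (exp (2 * pi))) = (1 - u) * euler_product u"
proof (cases "u = 1")
  case True
  have "euler_product (of_real (exp (2 * pi))) = 0"
    by (auto simp: euler_product_eq_0_iff intro!: exI[of _ 0])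
  then show ?thesis using True by simp
next
  case False
  let ?v = "u * of_real (exp (2 * pi))"
  let ?f = "\<lambda>n. 1 - ?v / of_real (exp (2 * pi * (real n + 1)))"
  have conv: "convergent_prod ?f"
    using euler.convergent[of ?v] by (simp add: weierstrass_factor_def)
  have "?f 0 = 1 - u" by simp
  then have "?f 0 \<noteq> 0" using False by simp
  from prodinf_split_head[OF conv this]
  have "(\<Prod>n. ?f (Suc n)) * (1 - u) = euler_product ?v"
    using False by (simp add: euler_product_def)
  moreover have "?f (Suc n) = 1 - u / of_real (exp (2 * pi * (real n + 1)))" for n
  proof -
    have "exp (2 * pi * (real (Suc n) + 1)) = exp (2 * pi) * exp (2 * pi * (real n + 1))"
      by (simp add: algebra_simps flip: exp_add)
    then show ?thesis by simp
  qed
  ultimately show ?thesis by (simp add: euler_product_def mult.commute)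
qed

lemma entire_eventually_nonzero:
  assumes "f holomorphic_on UNIV" "f b \<noteq> 0"
  shows "\<forall>\<^sub>F w in at z. f w \<noteq> 0"
  using non_zero_neighbour_alt[of f UNIV z b] assms by (auto elim: eventually_mono)

abbreviation \<omega> :: complex where "\<omega> \<equiv> of_real (sqrt pi)"

lemma omega_mult_omega: "\<omega> * \<omega> = of_real pi"
  by (simp flip: of_real_mult)

lemma omega_squared: "\<omega>\<^sup>2 = of_real pi"
  by (simp add: power2_eq_square omega_mult_omega del: of_real_mult)

text \<open>
  The Jacobi product of the sigma function of the lattice \<open>\<omega> (Z + i Z)\<close> without its factor
  \<open>sinh (\<omega> z)\<close>, hence without the zeros on the imaginary axis.
\<close>

definition slit_sigma :: "complex \<Rightarrow> complex" where
  "slit_sigma z = exp (- z\<^sup>2 / 2) * (euler_product (exp (2 * \<omega> * z)) * euler_product (exp (- (2 * \<omega> * z))))"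

definition lattice_sigma :: "complex \<Rightarrow> complex" where
  "lattice_sigma z = sinh (\<omega> * z) * slit_sigma z"

lemma slit_sigma_holomorphic: "slit_sigma holomorphic_on A"
  unfolding slit_sigma_def
  by (intro holomorphic_intros holomorphic_on_compose_gen[OF _ euler.holomorphic[of UNIV], unfolded o_def]) auto

lemma slit_sigma_0: "slit_sigma 0 \<noteq> 0"
  by (simp add: slit_sigma_def euler_product_1_nonzero)

lemma euler_product_exp_eq_0_iff:
  "euler_product (exp (2 * \<omega> * z)) = 0 \<longleftrightarrow> (\<exists>m n::int. m > 0 \<and> z = \<omega> * (of_int m + \<i> * of_int n))"
proof -
  have "euler_product (exp (2 * \<omega> * z)) = 0 \<longleftrightarrow> 
      (\<exists>k::nat. exp (2 * \<omega> * z) = exp (of_real (2 * pi * (real k + 1))))"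
    by (simp only: euler_product_eq_0_iff exp_of_real)
  also have "\<dots> \<longleftrightarrow> (\<exists>(k::nat) (n::int). 2 * \<omega> * z = 2 * \<omega> * (\<omega> * (of_int (int k + 1) + \<i> * of_int n)))"
  proof -
    have "2 * \<omega> * (\<omega> * (of_int (int k + 1) + \<i> * of_int n))
        = of_real (2 * pi * (real k + 1)) + of_int (2 * n) * of_real pi * \<i>" for k :: nat and n :: int
    proof -
      have "2 * \<omega> * (\<omega> * (of_int (int k + 1) + \<i> * of_int n)) 
          = 2 * (\<omega> * \<omega>) * (of_int (int k + 1) + \<i> * of_int n)"
        by (simp only: mult.assoc)
      also have "\<dots> = of_real (2 * pi * (real k + 1)) + of_int (2 * n) * of_real pi * \<i>"
        unfolding omega_mult_omega by (simp add: algebra_simps)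
      finally show ?thesis .
    qed
    then show ?thesis unfolding exp_eq by simp
  qed
  also have "\<dots> \<longleftrightarrow> (\<exists>(k::nat) (n::int). z = \<omega> * (of_int (int k + 1) + \<i> * of_int n))"
    by simp
  also have "\<dots> \<longleftrightarrow> (\<exists>m n::int. m > 0 \<and> z = \<omega> * (of_int m + \<i> * of_int n))"
  proof safe
    fix m n :: int assume "m > 0"
    then have "m = int (nat (m - 1)) + 1" by simp
    then show "\<exists>(k::nat) (n'::int). \<omega> * (of_int m + \<i> * of_int n) = \<omega> * (of_int (int k + 1) + \<i> * of_int n')"
      by (intro exI[of _ "nat (m - 1)"] exI[of _ n]) simp
  next
    fix k :: nat and n :: int
    show "\<exists>m n'::int. m > 0 \<and> \<omega> * (of_int (int k + 1) + \<i> * of_int n) = \<omega> * (of_int m + \<i> * of_int n')"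
      by (intro exI[of _ "int k + 1"] exI[of _ n]) simp
  qed
  finally show ?thesis .
qed

lemma slit_lattice_iff:
  "z \<in> square_lattice - vertical_line \<longleftrightarrow> (\<exists>m n::int. m \<noteq> 0 \<and> z = \<omega> * (of_int m + \<i> * of_int n))"
proof -
  have "\<omega> * (of_int m + \<i> * of_int n) \<in> vertical_line \<longleftrightarrow> m = 0" for m n :: int
  proof
    assume "\<omega> * (of_int m + \<i> * of_int n) \<in> vertical_line"
    then obtain k :: int where "\<omega> * (of_int m + \<i> * of_int n) = \<i> * \<omega> * of_int k"
      by (auto simp: vertical_line_def)
    then have "Re (\<omega> * (of_int m + \<i> * of_int n)) = Re (\<i> * \<omega> * of_int k)" by simp
    then show "m = 0" by simp
  qed (auto simp: vertical_line_def intro!: exI[of _ n])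
  then show ?thesis
    by (auto simp: square_lattice_def)
qed

lemma slit_sigma_eq_0_iff: "slit_sigma z = 0 \<longleftrightarrow> z \<in> square_lattice - vertical_line"
proof -
  have "slit_sigma z = 0 \<longleftrightarrow> euler_product (exp (2 * \<omega> * z)) = 0 \<or> euler_product (exp (2 * \<omega> * (- z))) = 0"
    by (simp add: slit_sigma_def)
  also have "\<dots> \<longleftrightarrow> (\<exists>m n::int. m \<noteq> 0 \<and> z = \<omega> * (of_int m + \<i> * of_int n))"
  proof -
    have "- z = \<omega> * (of_int m + \<i> * of_int n) \<longleftrightarrow> z = \<omega> * (of_int (- m) + \<i> * of_int (- n))" for m n :: int
      by (auto simp: algebra_simps minus_equation_iff[of z])
    then have "(\<exists>m n::int. m > 0 \<and> - z = \<omega> * (of_int m + \<i> * of_int n))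
       \<longleftrightarrow> (\<exists>m n::int. m < 0 \<and> z = \<omega> * (of_int m + \<i> * of_int n))"
      by (metis minus_minus neg_0_less_iff_less)
    then show ?thesis
      unfolding euler_product_exp_eq_0_iff by (metis linorder_neq_iff)
  qed
  finally show ?thesis by (simp only: slit_lattice_iff)
qed

lemma zorder_euler_product_exp:
  assumes "c \<noteq> 0" "euler_product (exp (c * z)) = 0"
  shows "zorder (\<lambda>w. euler_product (exp (c * w))) z = 1"
proof -
  have d: "((\<lambda>x. exp (c * x) - exp (c * z)) has_field_derivative c * exp (c * w)) (at w)" for w
    by (auto intro!: derivative_eq_intros)
  have "zorder (\<lambda>x. exp (c * x) - exp (c * z)) z = 1"
  proof (rule zorder_zero_eqI[of _ UNIV])
    show "(deriv ^^ nat 1) (\<lambda>x. exp (c * x) - exp (c * z)) z \<noteq> 0"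
      using DERIV_imp_deriv[OF d] assms(1) by simp
  qed (auto intro!: holomorphic_intros)
  moreover have "\<forall>\<^sub>F w in at z. exp (c * w) - exp (c * z) \<noteq> 0"
  proof (rule entire_eventually_nonzero)
    show "exp (c * (z + of_real pi * \<i> / c)) - exp (c * z) \<noteq> 0"
      using assms(1) by (simp add: ring_distribs exp_add)
  qed (auto intro!: holomorphic_intros)
  moreover have "zorder (euler_product \<circ> (\<lambda>w. exp (c * w))) z =
     zorder euler_product (exp (c * z)) * zorder (\<lambda>x. exp (c * x) - exp (c * z)) z"
    using calculation(2)
    by (intro zorder_compose' isolated_singularity_at_analytic not_essential_analytic 
        entire_eventually_nonzero[OF euler.holomorphic euler_product_1_nonzero] euler.analytic)
       (auto intro!: analytic_intros)
  ultimately show ?thesis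
    using zorder_euler_product[OF assms(2)] by (simp add: o_def)
qed

lemma zorder_slit_sigma:
  assumes "z \<in> square_lattice - vertical_line"
  shows "zorder slit_sigma z = 1"
proof -
  define F where "F = (\<lambda>c w. euler_product (exp (c * w)))"
  have F: "F c holomorphic_on UNIV" for c
    unfolding F_def 
    by (intro holomorphic_intros holomorphic_on_compose_gen[OF _ euler.holomorphic[of UNIV], unfolded o_def]) auto
  have F': "F c analytic_on A" for c A
    using F by (meson analytic_on_holomorphic open_UNIV subset_UNIV)
  have F0: "F c 0 \<noteq> 0" for c by (simp add: F_def euler_product_1_nonzero)
  let ?E = "\<lambda>z. exp (- z\<^sup>2 / 2) :: complex"
  have eq: "slit_sigma = (\<lambda>w. ?E w * (F (2 * \<omega>) w * F (- (2 * \<omega>)) w))"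
    by (simp add: slit_sigma_def F_def fun_eq_iff)
  have nz: "\<forall>\<^sub>F w in at z. slit_sigma w \<noteq> 0"
    by (rule entire_eventually_nonzero[OF slit_sigma_holomorphic slit_sigma_0])
  then have nz': "\<forall>\<^sub>F w in at z. F (2 * \<omega>) w * F (- (2 * \<omega>)) w \<noteq> 0"
    unfolding eq by (auto elim: eventually_mono)
  have E: "?E analytic_on {z}" by (auto intro!: analytic_intros)
  have "zorder slit_sigma z = zorder ?E z + zorder (\<lambda>w. F (2 * \<omega>) w * F (- (2 * \<omega>)) w) z"
    unfolding eq using nz unfolding eq by (intro zorder_times_analytic E analytic_intros F')
  also have "zorder ?E z = 0" by (rule zorder_eq_0I[OF E]) simp
  also have "zorder (\<lambda>w. F (2 * \<omega>) w * F (- (2 * \<omega>)) w) z = zorder (F (2 * \<omega>)) z + zorder (F (- (2 * \<omega>))) z"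
    using nz' by (intro zorder_times_analytic F')
  finally have zo: "zorder slit_sigma z = zorder (F (2 * \<omega>)) z + zorder (F (- (2 * \<omega>))) z" by simp
  have one: "zorder (F c) z = 1" if "c \<noteq> 0" "F c z = 0" for c
    using zorder_euler_product_exp[of c z] that by (simp add: F_def)
  have zero: "zorder (F c) z = 0" if "F c z \<noteq> 0" for c
    using that by (intro zorder_eq_0I F')
  obtain m n :: int where mn: "m \<noteq> 0" "z = \<omega> * (of_int m + \<i> * of_int n)"
    using assms unfolding slit_lattice_iff by blast
  have Re: "Re z = sqrt pi * of_int m" by (simp add: mn)
  \<comment> \<open>The two Euler products have their zeros in opposite half-planes, so exactly one of them vanishes.\<close>
  have p: "Re z > 0" if Fz: "F (2 * \<omega>) z = 0"
    using Fz euler_product_exp_eq_0_iff[of z] by (auto simp: F_def)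
  have n: "Re z < 0" if Fz: "F (- (2 * \<omega>)) z = 0"
  proof -
    obtain m n :: int where "m > 0" "- z = \<omega> * (of_int m + \<i> * of_int n)"
      using Fz euler_product_exp_eq_0_iff[of "- z"] by (auto simp: F_def)
    then have "Re (- z) = sqrt pi * of_int m" by simp
    moreover have "sqrt pi * of_int m > 0" using \<open>m > 0\<close> by simp
    ultimately show ?thesis by simp
  qed
  have "slit_sigma z = 0" using assms by (simp add: slit_sigma_eq_0_iff)
  then have "F (2 * \<omega>) z = 0 \<or> F (- (2 * \<omega>)) z = 0" by (simp add: eq)
  then show ?thesis
  proof
    assume *: "F (2 * \<omega>) z = 0"
    then have "F (- (2 * \<omega>)) z \<noteq> 0" using p n by fastforce
    then show ?thesis using zo one[OF _ *] zero by simp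
  next
    assume *: "F (- (2 * \<omega>)) z = 0"
    then have "F (2 * \<omega>) z \<noteq> 0" using p n by fastforce
    then show ?thesis using zo one[OF _ *] zero by simp
  qed
qed

section \<open>Periodicity and growth of the weighted sigma functions\<close>

lemma slit_sigma_plus_imag_period:
  "slit_sigma (z + \<i> * \<omega>) = exp (of_real pi / 2 - \<i> * \<omega> * z) * slit_sigma z"
proof -
  have "exp (- (z + \<i> * \<omega>)\<^sup>2 / 2) = exp (- z\<^sup>2 / 2) * exp (of_real pi / 2 - \<i> * \<omega> * z)"
  proof -
    have "(z + \<i> * \<omega>)\<^sup>2 = z\<^sup>2 + 2 * (\<i> * \<omega> * z) - of_real pi"
      by (simp add: power2_sum power_mult_distrib omega_squared)
    then have "- (z + \<i> * \<omega>)\<^sup>2 / 2 = - z\<^sup>2 / 2 + (of_real pi / 2 - \<i> * \<omega> * z)"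
      by (simp add: diff_divide_distrib add_divide_distrib)
    then show ?thesis by (simp only: exp_add)
  qed
  moreover have e: "2 * \<omega> * (z + \<i> * \<omega>) = 2 * \<omega> * z + 2 * of_real pi * \<i>"
    by (simp add: algebra_simps omega_mult_omega)
  have "exp (2 * \<omega> * (z + \<i> * \<omega>)) = exp (2 * \<omega> * z)" 
    unfolding e by (simp add: exp_add)
  moreover have "exp (- (2 * \<omega> * (z + \<i> * \<omega>))) = exp (- (2 * \<omega> * z))"
    unfolding e by (simp add: exp_diff)
  ultimately show ?thesis by (simp add: slit_sigma_def)
qed

lemma lattice_sigma_plus_imag_period:
  "lattice_sigma (z + \<i> * \<omega>) = - exp (of_real pi / 2 - \<i> * \<omega> * z) * lattice_sigma z"
proof -
  have "sinh (\<omega> * (z + \<i> * \<omega>)) = sinh (\<omega> * z + \<i> * of_real pi)"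
    by (simp add: algebra_simps omega_mult_omega)
  also have "\<dots> = - sinh (\<omega> * z)"
    by (simp add: sinh_field_def exp_add exp_diff diff_divide_distrib)
  finally show ?thesis by (simp add: lattice_sigma_def slit_sigma_plus_imag_period)
qed

text \<open>
  Under \<open>z \<mapsto> z + \<omega>\<close> the argument of one Euler product is multiplied by \<open>exp (2 pi)\<close> and that of the other
  is divided by it. The two linear factors that appear are exactly those needed to turn
  \<open>sinh (\<omega> z + pi)\<close> back into \<open>sinh (\<omega> z)\<close>.
\<close>

lemma lattice_sigma_plus_real_period:
  "lattice_sigma (z + \<omega>) = - exp (of_real pi / 2 + \<omega> * z) * lattice_sigma z"
proof -
  define a where "a = exp (\<omega> * z)"
  define c where "c = exp (complex_of_real pi)"
  have nz: "a \<noteq> 0" "c \<noteq> 0" by (simp_all add: a_def c_def)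
  have cc: "complex_of_real (exp (2 * pi)) = c * c"
    unfolding mult_2 exp_add by (simp add: c_def exp_of_real)
  have a2: "exp (2 * \<omega> * z) = a * a" "exp (- (2 * \<omega> * z)) = inverse (a * a)"
  proof -
    have "2 * \<omega> * z = \<omega> * z + \<omega> * z" by simp
    then show "exp (2 * \<omega> * z) = a * a" by (simp only: exp_add a_def)
    then show "exp (- (2 * \<omega> * z)) = inverse (a * a)" by (simp only: exp_minus)
  qed
  have e: "2 * \<omega> * (z + \<omega>) = 2 * \<omega> * z + (of_real pi + of_real pi)"
    by (simp add: algebra_simps omega_mult_omega)
  have a3: "exp (2 * \<omega> * (z + \<omega>)) = a * a * (c * c)" "exp (- (2 * \<omega> * (z + \<omega>))) = inverse (a * a * (c * c))"
    by (simp_all only: e exp_minus exp_add a2 c_def)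
  have g: "exp (- (z + \<omega>)\<^sup>2 / 2) = exp (- z\<^sup>2 / 2) * (exp (of_real pi / 2 + \<omega> * z) * inverse (a * a * c))"
  proof -
    have "(z + \<omega>)\<^sup>2 = z\<^sup>2 + 2 * (\<omega> * z) + of_real pi"
      by (simp add: power2_sum omega_squared)
    then have "- (z + \<omega>)\<^sup>2 / 2 = - z\<^sup>2 / 2 + ((of_real pi / 2 + \<omega> * z) + - (\<omega> * z + \<omega> * z + of_real pi))"
      by (simp add: diff_divide_distrib add_divide_distrib)
    then show ?thesis by (simp only: exp_add exp_minus a_def c_def)
  qed
  have sh: "sinh (\<omega> * z) = (a - inverse a) / 2"
    by (simp add: sinh_field_def a_def exp_minus)
  have sh': "sinh (\<omega> * (z + \<omega>)) = (a * c - inverse (a * c)) / 2"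
  proof -
    have "\<omega> * (z + \<omega>) = \<omega> * z + of_real pi" by (simp add: distrib_left omega_mult_omega)
    then show ?thesis by (simp only: sinh_field_def exp_minus exp_add a_def c_def)
  qed
  have E1: "euler_product (a * a * (c * c)) = (1 - a * a) * euler_product (a * a)"
    using euler_product_shift[of "a * a"] by (simp add: cc)
  have E2: "euler_product (inverse (a * a)) = 
     (1 - inverse (a * a * (c * c))) * euler_product (inverse (a * a * (c * c)))"
  proof -
    have "inverse (a * a * (c * c)) * (c * c) = inverse (a * a)" using nz by (simp add: field_simps)
    then show ?thesis
      using euler_product_shift[of "inverse (a * a * (c * c))"] by (simp only: cc)
  qed
  have key: "(a * c - inverse (a * c)) * inverse (a * a * c) * (1 - a * a)
      = - ((a - inverse a) * (1 - inverse (a * a * (c * c))))"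
    using nz by (simp add: divide_simps) (simp add: algebra_simps)
  have "lattice_sigma (z + \<omega>) = ((a * c - inverse (a * c)) * inverse (a * a * c) * (1 - a * a)) * 
     (exp (- z\<^sup>2 / 2) * exp (of_real pi / 2 + \<omega> * z) * euler_product (a * a)
       * euler_product (inverse (a * a * (c * c))) / 2)"
    unfolding lattice_sigma_def slit_sigma_def a3 g sh' E1 by simp
  also have "\<dots> = - exp (of_real pi / 2 + \<omega> * z) * lattice_sigma z"
    unfolding lattice_sigma_def slit_sigma_def a2 sh E2 key by simp
  finally show ?thesis .
qed


definition gauss :: "complex \<Rightarrow> real" where
  "gauss z = exp (- (norm z)\<^sup>2 / 2)"

lemma gauss_pos [simp]: "gauss z > 0"
  by (simp add: gauss_def)

lemma gauss_plus: "gauss (z + w) = gauss z * exp (- Re (z * cnj w) - (norm w)\<^sup>2 / 2)"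
proof -
  have "(norm (z + w))\<^sup>2 = (norm z)\<^sup>2 + (norm w)\<^sup>2 + 2 * Re (z * cnj w)"
    by (simp only: cmod_power2) (simp add: power2_eq_square algebra_simps)
  then have "- (norm (z + w))\<^sup>2 / 2 = - (norm z)\<^sup>2 / 2 + (- Re (z * cnj w) - (norm w)\<^sup>2 / 2)"
    by linarith
  then show ?thesis by (simp only: gauss_def exp_add)
qed

lemma norm_omega_squared: "(norm \<omega>)\<^sup>2 = pi" "(norm (\<i> * \<omega>))\<^sup>2 = pi"
  by (simp_all add: norm_mult)

lemma exp_mult_exp_cancel: "a + b = 0 \<Longrightarrow> exp a * (x * exp b) = (x::real)"
  by (simp add: mult.commute[of x] flip: mult.assoc exp_add)

lemma weighted_slit_sigma_periodic:
  "norm (slit_sigma (z + \<i> * \<omega>)) * gauss (z + \<i> * \<omega>) = norm (slit_sigma z) * gauss z"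
proof -
  have "norm (slit_sigma (z + \<i> * \<omega>)) * gauss (z + \<i> * \<omega>) = exp (Re (of_real pi / 2 - \<i> * \<omega> * z)) * 
     ((norm (slit_sigma z) * gauss z) * exp (- Re (z * cnj (\<i> * \<omega>)) - (norm (\<i> * \<omega>))\<^sup>2 / 2))"
    unfolding slit_sigma_plus_imag_period gauss_plus by (simp add: norm_mult)
  also have "\<dots> = norm (slit_sigma z) * gauss z"
    by (rule exp_mult_exp_cancel, subst norm_omega_squared) (simp add: mult.commute)
  finally show ?thesis .
qed

text \<open>
  The multipliers of \<open>lattice_sigma\<close> have the same modulus as those of \<open>exp (\<bar>z\<bar>^2 / 2)\<close> because
  \<open>\<omega>^2 = pi\<close>.
\<close>

lemma weighted_sigma_periodic:
  "norm (lattice_sigma (z + \<i> * \<omega>)) * gauss (z + \<i> * \<omega>) = norm (lattice_sigma z) * gauss z"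
  "norm (lattice_sigma (z + \<omega>)) * gauss (z + \<omega>) = norm (lattice_sigma z) * gauss z"
proof -
  have "norm (lattice_sigma (z + \<i> * \<omega>)) * gauss (z + \<i> * \<omega>) = exp (Re (of_real pi / 2 - \<i> * \<omega> * z)) * 
     ((norm (lattice_sigma z) * gauss z) * exp (- Re (z * cnj (\<i> * \<omega>)) - (norm (\<i> * \<omega>))\<^sup>2 / 2))"
    unfolding lattice_sigma_plus_imag_period gauss_plus by (simp add: norm_mult)
  also have "\<dots> = norm (lattice_sigma z) * gauss z"
    by (rule exp_mult_exp_cancel, subst norm_omega_squared) (simp add: mult.commute)
  finally show "norm (lattice_sigma (z + \<i> * \<omega>)) * gauss (z + \<i> * \<omega>) = norm (lattice_sigma z) * gauss z" .
  have "norm (lattice_sigma (z + \<omega>)) * gauss (z + \<omega>) = exp (Re (of_real pi / 2 + \<omega> * z)) * 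
     ((norm (lattice_sigma z) * gauss z) * exp (- Re (z * cnj \<omega>) - (norm \<omega>)\<^sup>2 / 2))"
    unfolding lattice_sigma_plus_real_period gauss_plus by (simp add: norm_mult)
  also have "\<dots> = norm (lattice_sigma z) * gauss z"
    by (rule exp_mult_exp_cancel, subst norm_omega_squared) (simp add: mult.commute)
  finally show "norm (lattice_sigma (z + \<omega>)) * gauss (z + \<omega>) = norm (lattice_sigma z) * gauss z" .
qed

lemma int_period:
  fixes F :: "complex \<Rightarrow> 'a"
  assumes per: "\<And>z. F (z + p) = F z"
  shows "F (z + of_int n * p) = F z"
proof (induction n rule: int_induct[where k = 0])
  case (step1 i)
  have "F (z + of_int (i + 1) * p) = F ((z + of_int i * p) + p)" by (simp add: algebra_simps)
  then show ?case using step1 per by simp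
next
  case (step2 i)
  have "F (z + of_int i * p) = F ((z + of_int (i - 1) * p) + p)" by (simp add: algebra_simps)
  then show ?case using step2 per by simp
qed simp

lemma real_mod_period:
  assumes "p > 0"
  obtains n :: int where "0 \<le> x + of_int n * p" "x + of_int n * p \<le> (p::real)"
proof
  show "0 \<le> x + of_int (- \<lfloor>x / p\<rfloor>) * p"
    using floor_divide_lower[OF assms, of x] by simp
  show "x + of_int (- \<lfloor>x / p\<rfloor>) * p \<le> p"
    using floor_divide_upper[OF assms, of x] by (simp add: algebra_simps)
qed

lemma gauss_continuous: "continuous_on A gauss"
  unfolding gauss_def by (intro continuous_intros) auto

lemma slit_sigma_continuous: "continuous_on A slit_sigma"
  by (rule holomorphic_on_imp_continuous_on[OF slit_sigma_holomorphic])

lemma lattice_sigma_continuous: "continuous_on A lattice_sigma"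
  unfolding lattice_sigma_def sinh_field_def
  by (intro holomorphic_on_imp_continuous_on holomorphic_intros slit_sigma_holomorphic) auto

lemma lattice_sigma_eq_0_iff: "lattice_sigma z = 0 \<longleftrightarrow> z \<in> square_lattice"
proof -
  have "sinh (\<omega> * z) = 0 \<longleftrightarrow> z \<in> vertical_line"
  proof -
    have "sinh (\<omega> * z) = 0 \<longleftrightarrow> exp (\<omega> * z) = exp (- (\<omega> * z))"
      by (simp add: sinh_field_def)
    also have "\<dots> \<longleftrightarrow> (\<exists>n::int. \<omega> * z = - (\<omega> * z) + of_int (2 * n) * of_real pi * \<i>)"
      by (simp add: exp_eq)
    also have "\<dots> \<longleftrightarrow> (\<exists>n::int. z = \<i> * \<omega> * of_int n)"
    proof -
      have "\<omega> * z = - (\<omega> * z) + of_int (2 * n) * of_real pi * \<i> \<longleftrightarrow> z = \<i> * \<omega> * of_int n" for n :: int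
      proof -
        have "\<omega> * z = - (\<omega> * z) + of_int (2 * n) * of_real pi * \<i> \<longleftrightarrow> 2 * \<omega> * z = 2 * \<omega> * (\<i> * \<omega> * of_int n)"
          by (simp add: omega_mult_omega [symmetric] algebra_simps eq_neg_iff_add_eq_0 del: of_real_mult)
        then show ?thesis by simp
      qed
      then show ?thesis by simp
    qed
    finally show ?thesis by (simp add: vertical_line_def)
  qed
  moreover have "vertical_line \<subseteq> square_lattice"
    by (force simp: vertical_line_def square_lattice_def intro: exI[of _ 0])
  ultimately show ?thesis
    by (auto simp: lattice_sigma_def slit_sigma_eq_0_iff)
qed

lemma weighted_sigma_bounded:
  obtains C where "\<And>z. norm (lattice_sigma z) * gauss z \<le> C"
proof -
  define W where "W = (\<lambda>z. norm (lattice_sigma z) * gauss z)"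
  have per: "W (z + \<omega>) = W z" "W (z + \<i> * \<omega>) = W z" for z
    unfolding W_def by (rule weighted_sigma_periodic)+
  have "compact (W ` cbox 0 (Complex (sqrt pi) (sqrt pi)))"
    unfolding W_def by (intro compact_continuous_image continuous_intros lattice_sigma_continuous gauss_continuous) auto
  then obtain C where C: "\<And>z. z \<in> cbox 0 (Complex (sqrt pi) (sqrt pi)) \<Longrightarrow> W z \<le> C"
    by (meson bounded_imp_bdd_above compact_imp_bounded bdd_above.E imageI)
  show ?thesis
  proof (rule that)
    fix z :: complex
    obtain m :: int where m: "0 \<le> Re z + of_int m * sqrt pi" "Re z + of_int m * sqrt pi \<le> sqrt pi"
      by (rule real_mod_period[of "sqrt pi" "Re z"]) auto
    obtain n :: int where n: "0 \<le> Im z + of_int n * sqrt pi" "Im z + of_int n * sqrt pi \<le> sqrt pi"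
      by (rule real_mod_period[of "sqrt pi" "Im z"]) auto
    have "W z = W (z + of_int m * \<omega> + of_int n * (\<i> * \<omega>))"
      by (simp only: int_period[of W, OF per(1)] int_period[of W, OF per(2)])
    also have "\<dots> \<le> C" using m n by (intro C) (auto simp: in_cbox_complex_iff)
    finally show "norm (lattice_sigma z) * gauss z \<le> C" by (simp add: W_def)
  qed
qed

text \<open>
  These lines avoid the lattice uniformly, and they bound arbitrarily large squares centred at the origin.
\<close>

definition half_grid :: "complex set" where
  "half_grid = {z. \<exists>k::int. Re z = (of_int k + 1/2) * sqrt pi \<or> Im z = (of_int k + 1/2) * sqrt pi}"

lemma weighted_sigma_half_grid_lower:
  obtains c where "c > 0" "\<And>z. z \<in> half_grid \<Longrightarrow> c \<le> norm (lattice_sigma z) * gauss z"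
proof -
  define W where "W = (\<lambda>z. norm (lattice_sigma z) * gauss z)"
  have per: "W (z + \<omega>) = W z" "W (z + \<i> * \<omega>) = W z" for z
    unfolding W_def by (rule weighted_sigma_periodic)+
  have W: "continuous_on A W" for A
    unfolding W_def by (intro continuous_intros lattice_sigma_continuous gauss_continuous)
  have half: "of_int (k::int) \<noteq> (1/2::real)" for k
  proof
    assume "of_int k = (1/2::real)"
    then have "of_int (2 * k) = (1::real)" by simp
    then have "2 * k = 1" by linarith
    then show False by presburger
  qed
  \<comment> \<open>The grid lines inside one period cell form a compact set on which the continuous function \<open>W\<close> has no zeros.\<close>
  define K where "K = cbox 0 (Complex (sqrt pi) (sqrt pi)) \<inter> {z. Re z = sqrt pi / 2 \<or> Im z = sqrt pi / 2}"
  have "closed {z. Re z = sqrt pi / 2 \<or> Im z = sqrt pi / 2}"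
    by (intro closed_Collect_disj closed_Collect_eq continuous_intros)
  then have K: "compact K" unfolding K_def by (intro compact_Int_closed) auto
  have "Complex (sqrt pi / 2) 0 \<in> K" by (simp add: K_def in_cbox_complex_iff)
  then obtain z0 where z0: "z0 \<in> K" "\<And>z. z \<in> K \<Longrightarrow> W z0 \<le> W z"
    using continuous_attains_inf[OF K _ W] by blast
  have "z0 \<notin> square_lattice"
  proof
    assume "z0 \<in> square_lattice"
    then obtain m n :: int where z: "z0 = \<omega> * (of_int m + \<i> * of_int n)"
      by (auto simp: square_lattice_def)
    have "Re z0 = sqrt pi * of_int m" "Im z0 = sqrt pi * of_int n" by (simp_all add: z)
    then have "of_int m = (1/2::real) \<or> of_int n = (1/2::real)"
      using z0(1) by (auto simp: K_def field_simps)
    then show False using half by blast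
  qed
  then have pos: "W z0 > 0" by (simp add: W_def lattice_sigma_eq_0_iff)
  show ?thesis
  proof (rule that[OF pos])
    fix z assume "z \<in> half_grid"
    then obtain k :: int where k: "Re z = (of_int k + 1/2) * sqrt pi \<or> Im z = (of_int k + 1/2) * sqrt pi"
      by (auto simp: half_grid_def)
    obtain m :: int where m: "0 \<le> Re z + of_int m * sqrt pi" "Re z + of_int m * sqrt pi \<le> sqrt pi"
        "Re z = (of_int k + 1/2) * sqrt pi \<longrightarrow> Re z + of_int m * sqrt pi = sqrt pi / 2"
    proof (cases "Re z = (of_int k + 1/2) * sqrt pi")
      case True
      then show ?thesis by (intro that[of "- k"]) (simp_all add: algebra_simps)
    next
      case False
      show ?thesis by (rule real_mod_period[of "sqrt pi" "Re z"]) (use that False in auto)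
    qed
    obtain n :: int where n: "0 \<le> Im z + of_int n * sqrt pi" "Im z + of_int n * sqrt pi \<le> sqrt pi"
        "Im z = (of_int k + 1/2) * sqrt pi \<longrightarrow> Im z + of_int n * sqrt pi = sqrt pi / 2"
    proof (cases "Im z = (of_int k + 1/2) * sqrt pi")
      case True
      then show ?thesis by (intro that[of "- k"]) (simp_all add: algebra_simps)
    next
      case False
      show ?thesis by (rule real_mod_period[of "sqrt pi" "Im z"]) (use that False in auto)
    qed
    have "z + of_int m * \<omega> + of_int n * (\<i> * \<omega>) \<in> K"
      using m n k by (auto simp: K_def in_cbox_complex_iff)
    then have "W z0 \<le> W (z + of_int m * \<omega> + of_int n * (\<i> * \<omega>))" by (rule z0(2))
    also have "\<dots> = W z"
      by (simp only: int_period[of W, OF per(1)] int_period[of W, OF per(2)])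
    finally show "W z0 \<le> norm (lattice_sigma z) * gauss z" by (simp add: W_def)
  qed
qed

lemma norm_sinh_upper: "norm (sinh w) \<le> exp \<bar>Re w\<bar>" for w :: complex
proof -
  have "norm (sinh w) \<le> (norm (exp w) + norm (exp (- w))) / 2"
    using norm_triangle_ineq4[of "exp w" "exp (- w)"] unfolding sinh_field_def
    by (simp add: norm_divide)
  also have "\<dots> \<le> exp \<bar>Re w\<bar>"
  proof -
    have "norm (exp w) + norm (exp (- w)) \<le> exp \<bar>Re w\<bar> + exp \<bar>Re w\<bar>" 
      unfolding norm_exp_eq_Re by (rule add_mono) simp_all
    then show ?thesis by simp
  qed
  finally show ?thesis .
qed

lemma norm_sinh_lower:
  fixes w :: complex
  assumes "\<bar>Re w\<bar> \<ge> 1"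
  shows "exp \<bar>Re w\<bar> \<le> 4 * norm (sinh w)"
proof -
  have e: "2 * exp (- x) \<le> exp x" if "x \<ge> 1" for x :: real
  proof -
    have "2 \<le> exp (2 * x)" using that exp_ge_add_one_self[of "2 * x"] by linarith
    then have "2 * exp (- x) \<le> exp (2 * x) * exp (- x)" by (intro mult_right_mono) auto
    also have "\<dots> = exp x" by (simp flip: exp_add)
    finally show ?thesis .
  qed
  have "exp \<bar>Re w\<bar> - exp (- \<bar>Re w\<bar>) = \<bar>exp (Re w) - exp (- Re w)\<bar>"
    by (auto simp: abs_if)
  also have "\<dots> = \<bar>norm (exp w) - norm (exp (- w))\<bar>" by simp
  also have "\<dots> \<le> norm (exp w - exp (- w))" by (rule norm_triangle_ineq3)
  also have "\<dots> = 2 * norm (sinh w)" by (simp add: sinh_field_def norm_divide)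
  finally show ?thesis using e[OF assms] by linarith
qed

text \<open>
  Away from the imaginary axis one divides the bounded weighted sigma function by \<open>sinh (\<omega> z)\<close>.
  This fails near the zeros of \<open>sinh\<close>, but there the weighted slit sigma function is periodic along the
  axis and continuous, hence bounded on the strip.
\<close>

lemma weighted_slit_sigma_upper:
  obtains C where "C \<ge> 0" "\<And>z. norm (slit_sigma z) * gauss z \<le> C * exp (- sqrt pi * \<bar>Re z\<bar>)"
proof -
  define P where "P = (\<lambda>z. norm (slit_sigma z) * gauss z)"
  have per: "P (z + \<i> * \<omega>) = P z" for z
    unfolding P_def by (rule weighted_slit_sigma_periodic)
  have P_nonneg: "P z \<ge> 0" for z by (simp add: P_def less_imp_le)
  obtain C1 where C1: "\<And>z. norm (lattice_sigma z) * gauss z \<le> C1"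
    using weighted_sigma_bounded by blast
  have "compact (P ` cbox (Complex (-1 / sqrt pi) 0) (Complex (1 / sqrt pi) (sqrt pi)))"
    unfolding P_def by (intro compact_continuous_image continuous_intros slit_sigma_continuous gauss_continuous) auto
  then obtain C2 where C2: "\<And>z. z \<in> cbox (Complex (-1 / sqrt pi) 0) (Complex (1 / sqrt pi) (sqrt pi)) \<Longrightarrow> P z \<le> C2"
    by (meson bounded_imp_bdd_above compact_imp_bounded bdd_above.E imageI)
  have C1_nonneg: "C1 \<ge> 0"
    using order_trans[OF _ C1[of 0], of 0] by (simp add: less_imp_le)
  have far: "P z \<le> 4 * C1 * exp (- sqrt pi * \<bar>Re z\<bar>)" if "1 \<le> sqrt pi * \<bar>Re z\<bar>" for z
  proof -
    have Re: "\<bar>Re (\<omega> * z)\<bar> = sqrt pi * \<bar>Re z\<bar>" by (simp add: abs_mult)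
    then have "exp (sqrt pi * \<bar>Re z\<bar>) * P z \<le> 4 * norm (sinh (\<omega> * z)) * P z"
      using norm_sinh_lower[of "\<omega> * z"] that P_nonneg[of z] by (intro mult_right_mono) auto
    also have "\<dots> = 4 * (norm (lattice_sigma z) * gauss z)" by (simp add: P_def lattice_sigma_def norm_mult)
    also have "\<dots> \<le> 4 * C1" using C1 by simp
    finally show ?thesis by (simp add: exp_minus field_simps)
  qed
  have near: "P z \<le> \<bar>C2\<bar> * exp 1 * exp (- sqrt pi * \<bar>Re z\<bar>)" if "sqrt pi * \<bar>Re z\<bar> \<le> 1" for z
  proof -
    obtain n :: int where n: "0 \<le> Im z + of_int n * sqrt pi" "Im z + of_int n * sqrt pi \<le> sqrt pi"
      by (rule real_mod_period[of "sqrt pi" "Im z"]) auto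
    have "\<bar>Re z\<bar> \<le> 1 / sqrt pi" using that by (simp add: field_simps)
    then have "- 1 / sqrt pi \<le> Re z" "Re z \<le> 1 / sqrt pi" by (simp_all add: abs_le_iff) 
    then have "P (z + of_int n * (\<i> * \<omega>)) \<le> C2"
      using n by (intro C2) (auto simp: in_cbox_complex_iff)
    then have "P z \<le> \<bar>C2\<bar> * 1" unfolding int_period[of P, OF per] by simp
    also have "\<dots> \<le> \<bar>C2\<bar> * (exp 1 * exp (- sqrt pi * \<bar>Re z\<bar>))"
      using that by (intro mult_left_mono) (auto simp flip: exp_add)
    finally show ?thesis by simp
  qed
  show ?thesis
  proof (rule that[of "4 * C1 + \<bar>C2\<bar> * exp 1"])
    show "4 * C1 + \<bar>C2\<bar> * exp 1 \<ge> 0" using C1_nonneg by simp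
    fix z
    show "norm (slit_sigma z) * gauss z \<le> (4 * C1 + \<bar>C2\<bar> * exp 1) * exp (- sqrt pi * \<bar>Re z\<bar>)"
    proof (cases "1 \<le> sqrt pi * \<bar>Re z\<bar>")
      case True
      have "0 \<le> \<bar>C2\<bar> * exp 1 * exp (- sqrt pi * \<bar>Re z\<bar>)" by simp
      then show ?thesis using far[OF True] unfolding P_def distrib_right by linarith
    next
      case False
      then have *: "sqrt pi * \<bar>Re z\<bar> \<le> 1" by simp
      have "0 \<le> 4 * C1 * exp (- sqrt pi * \<bar>Re z\<bar>)" using C1_nonneg by simp
      then show ?thesis using near[OF *] unfolding P_def distrib_right by linarith
    qed
  qed
qed

lemma weighted_slit_sigma_half_grid_lower:
  obtains c where "c > 0"
    "\<And>z. z \<in> half_grid \<Longrightarrow> c * exp (- sqrt pi * \<bar>Re z\<bar>) \<le> norm (slit_sigma z) * gauss z"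
proof -
  obtain c where c: "c > 0" "\<And>z. z \<in> half_grid \<Longrightarrow> c \<le> norm (lattice_sigma z) * gauss z"
    by (rule weighted_sigma_half_grid_lower) blast
  show ?thesis
  proof (rule that[OF c(1)])
    fix z assume "z \<in> half_grid"
    then have "c \<le> norm (sinh (\<omega> * z)) * (norm (slit_sigma z) * gauss z)"
      using c(2)[of z] by (simp add: lattice_sigma_def norm_mult mult.assoc)
    also have "\<dots> \<le> exp (sqrt pi * \<bar>Re z\<bar>) * (norm (slit_sigma z) * gauss z)"
      using norm_sinh_upper[of "\<omega> * z"] by (intro mult_right_mono) (auto simp: abs_mult less_imp_le)
    finally show "c * exp (- sqrt pi * \<bar>Re z\<bar>) \<le> norm (slit_sigma z) * gauss z"
      by (simp add: exp_minus field_simps)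
  qed
qed

section \<open>Entire functions of exponential type without zeros\<close>

text \<open>
  The map \<open>w \<mapsto> w / (2 M - w)\<close> sends the half-plane \<open>Re w < M\<close> into the unit disc and fixes the origin,
  so the Schwarz lemma applies.
\<close>

lemma Borel_Caratheodory_half_radius:
  assumes h: "h holomorphic_on UNIV" and h0: "h 0 = 0" and R: "R > 0"
    and le: "\<And>z. norm z < R \<Longrightarrow> Re (h z) < M" and z: "norm z = R / 2"
  shows "norm (h z) \<le> 2 * M"
proof -
  have M: "M > 0" using le[of 0] h0 R by simp
  define g where "g = (\<lambda>u. h (of_real R * u) / (2 * of_real M - h (of_real R * u)))"
  have lt: "norm (h (of_real R * u)) < norm (2 * of_real M - h (of_real R * u))"
    and nz: "2 * of_real M - h (of_real R * u) \<noteq> 0" if "norm u < 1" for u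
  proof -
    let ?w = "h (of_real R * u)"
    have "Re ?w < M" using R that by (intro le) (simp add: norm_mult)
    then have "M * Re ?w < M * M" using M by simp
    then have "(norm ?w)\<^sup>2 < (norm (2 * of_real M - ?w))\<^sup>2"
      unfolding cmod_power2 by (simp add: power2_eq_square algebra_simps)
    then show *: "norm ?w < norm (2 * of_real M - ?w)"
      by (rule power2_less_imp_less) simp
    show "2 * of_real M - ?w \<noteq> 0"
    proof
      assume 0: "2 * of_real M - ?w = 0"
      show False using * unfolding 0 by simp
    qed
  qed
  have hR: "(\<lambda>u. h (of_real R * u)) holomorphic_on ball 0 1"
    by (intro holomorphic_on_compose_gen[OF _ h, unfolded o_def] holomorphic_intros) auto
  have g: "g holomorphic_on ball 0 1"
    unfolding g_def using nz by (intro holomorphic_intros hR) auto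
  have "norm (g (z / of_real R)) \<le> norm (z / of_real R)"
  proof -
    have "\<forall>\<xi>. norm \<xi> < 1 \<longrightarrow> norm (g \<xi>) \<le> norm \<xi>"
    proof (rule conjunct1[OF conjunct1[OF Schwarz_Lemma'[OF g]]])
      show "g 0 = 0" by (simp add: g_def h0)
      show "norm (g u) < 1" if "norm u < 1" for u
        using lt[OF that] nz[OF that] by (simp add: g_def norm_divide)
    qed
    moreover have "norm (z / of_real R) < 1" using z R by (simp add: norm_divide)
    ultimately show ?thesis by blast
  qed
  also have "\<dots> = 1 / 2" using z R by (simp add: norm_divide)
  finally have half: "norm (h z / (2 * of_real M - h z)) \<le> 1 / 2"
    using R by (simp add: g_def)
  have "2 * of_real M - h z \<noteq> 0"
    using nz[of "z / of_real R"] z R by (simp add: norm_divide)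
  then have "2 * norm (h z) \<le> norm (2 * of_real M - h z)"
    using half by (simp add: norm_divide field_simps)
  also have "\<dots> \<le> 2 * M + norm (h z)"
    using norm_triangle_ineq4[of "2 * of_real M" "h z"] M by (simp add: norm_mult)
  finally show ?thesis by simp
qed

text \<open>
  A linear one-sided bound for the real part on a disc of twice the radius gives a linear
  bound for the modulus, and Liouville's theorem for polynomials finishes the argument.
\<close>

lemma entire_affine_of_Re_growth:
  assumes h: "h holomorphic_on UNIV" and B: "B \<ge> 0" and le: "\<And>z. Re (h z) \<le> A + B * norm z"
  obtains \<alpha> \<beta> where "\<And>z. h z = \<alpha> + \<beta> * z"
proof -
  define k where "k = (\<lambda>z. h z - h 0)"
  define D where "D = \<bar>A\<bar> + norm (h 0) + 1"
  have k: "k holomorphic_on UNIV" unfolding k_def by (intro holomorphic_intros h)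
  have growth: "norm (k z) \<le> (2 * D + 4 * B) * norm z ^ 1" if "1 \<le> norm z" for z
  proof -
    have "Re (k w) < D + B * (2 * norm z)" if "norm w < 2 * norm z" for w
    proof -
      have "B * norm w \<le> B * (2 * norm z)" using that B by (intro mult_left_mono) auto
      moreover have "- Re (h 0) \<le> norm (h 0)" using abs_Re_le_cmod[of "h 0"] by linarith
      ultimately show ?thesis using le[of w] unfolding k_def D_def
        by simp
    qed
    then have "norm (k z) \<le> 2 * (D + B * (2 * norm z))"
      using that by (intro Borel_Caratheodory_half_radius[of k "2 * norm z"] k) (auto simp: k_def)
    also have "\<dots> \<le> 2 * (D * norm z + B * (2 * norm z))"
    proof -
      have "D \<ge> 0" by (simp add: D_def)
      then show ?thesis using mult_left_mono[OF that, of D] by simp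
    qed
    finally show ?thesis by (simp add: algebra_simps)
  qed
  have "k z = (\<Sum>i\<le>1. (deriv ^^ i) k 0 / fact i * z ^ i)" for z
    by (rule Liouville_polynomial[OF k growth])
  moreover have "k 0 = 0" by (simp add: k_def)
  ultimately have "k z = deriv k 0 * z" for z by (simp add: atMost_Suc)
  moreover have "h z = h 0 + k z" for z by (simp add: k_def)
  ultimately have "h z = h 0 + deriv k 0 * z" for z by metis
  then show ?thesis by (rule that)
qed

text \<open>
  The growth is only assumed on the grid because the quotients to which this is applied are not
  directly controlled near the lattice points. The grid contains the boundaries of arbitrarily large squares,
  so the maximum principle extends the bound to the whole plane.
\<close>

lemma half_grid_growth_imp_exponential_type:
  assumes H: "H holomorphic_on UNIV"
    and le: "\<And>z. z \<in> half_grid \<Longrightarrow> norm z \<ge> R \<Longrightarrow> norm (H z) \<le> C * exp (sqrt pi * \<bar>Re z\<bar>)"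
  obtains A where "A > 0" "\<And>z::complex. norm (H z) \<le> A * exp (sqrt pi * norm z)"
proof (rule that)
  define D where "D = \<bar>R\<bar> + 2 * sqrt pi"
  show "0 < (\<bar>C\<bar> + 1) * exp (sqrt pi * D)" by simp
  fix z :: complex
  \<comment> \<open>The maximum principle is applied on a square with edges in the grid, of half side \<open>r\<close> close to \<open>norm z\<close>.\<close>
  define k where "k = nat \<lceil>(\<bar>R\<bar> + norm z) / sqrt pi\<rceil>"
  define r where "r = (real k + 1/2) * sqrt pi"
  have "real k = of_int \<lceil>(\<bar>R\<bar> + norm z) / sqrt pi\<rceil>" by (simp add: k_def)
  then have "(\<bar>R\<bar> + norm z) / sqrt pi \<le> real k" "real k \<le> (\<bar>R\<bar> + norm z) / sqrt pi + 1"
    using le_of_int_ceiling[of "(\<bar>R\<bar> + norm z) / sqrt pi"]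
      of_int_ceiling_le_add_one[of "(\<bar>R\<bar> + norm z) / sqrt pi"] by simp_all
  then have "\<bar>R\<bar> + norm z \<le> real k * sqrt pi" "real k * sqrt pi \<le> \<bar>R\<bar> + norm z + sqrt pi"
    by (simp_all add: field_simps)
  then have r: "\<bar>R\<bar> + norm z \<le> r" "r \<le> norm z + D"
    unfolding r_def D_def by (simp_all add: distrib_right add_increasing2)
  have "r > 0" by (simp add: r_def)
  let ?S = "cbox (Complex (- r) (- r)) (Complex r r)"
  have "norm (H z) \<le> \<bar>C\<bar> * exp (sqrt pi * r)"
  proof (rule maximum_modulus_frontier[of H ?S])
    show "z \<in> ?S"
      using abs_Re_le_cmod[of z] abs_Im_le_cmod[of z] r by (auto simp: in_cbox_complex_iff)
    show "H holomorphic_on interior ?S" "continuous_on (closure ?S) H"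
      using H by (auto intro: holomorphic_on_subset holomorphic_on_imp_continuous_on)
    fix w assume "w \<in> frontier ?S"
    then have w: "w \<in> ?S" "w \<notin> box (Complex (- r) (- r)) (Complex r r)"
      by (auto simp: frontier_def)
    then have edge: "\<bar>Re w\<bar> = r \<or> \<bar>Im w\<bar> = r" and Re: "\<bar>Re w\<bar> \<le> r"
      by (auto simp: in_cbox_complex_iff in_box_complex_iff abs_if)
    have "\<exists>j::int. x = (of_int j + 1/2) * sqrt pi" if "\<bar>x\<bar> = r" for x
    proof (cases "x = r")
      case True
      then show ?thesis by (intro exI[of _ "int k"]) (simp add: r_def)
    next
      case False
      then have "x = - r" using that by linarith
      then show ?thesis by (intro exI[of _ "- int k - 1"]) (simp add: r_def algebra_simps)
    qed
    then have "w \<in> half_grid"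
      using edge unfolding half_grid_def by blast
    moreover have "norm w \<ge> R"
      using edge r abs_Re_le_cmod[of w] abs_Im_le_cmod[of w] norm_ge_zero[of z] by linarith
    ultimately have "norm (H w) \<le> C * exp (sqrt pi * \<bar>Re w\<bar>)" by (rule le)
    also have "\<dots> \<le> \<bar>C\<bar> * exp (sqrt pi * r)"
      using Re by (intro mult_mono) auto
    finally show "norm (H w) \<le> \<bar>C\<bar> * exp (sqrt pi * r)" .
  qed auto
  also have "\<dots> \<le> (\<bar>C\<bar> + 1) * exp (sqrt pi * D + sqrt pi * norm z)"
    using r by (intro mult_mono) (auto simp flip: distrib_left simp: add.commute)
  also have "\<dots> = (\<bar>C\<bar> + 1) * exp (sqrt pi * D) * exp (sqrt pi * norm z)"
    by (simp add: exp_add)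
  finally show "norm (H z) \<le> (\<bar>C\<bar> + 1) * exp (sqrt pi * D) * exp (sqrt pi * norm z)" .
qed

lemma nonvanishing_exponential_type:
  assumes H: "H holomorphic_on UNIV" and nz: "\<And>z. H z \<noteq> 0"
    and AB: "A > 0" "B \<ge> 0" "\<And>z. norm (H z) \<le> A * exp (B * norm z)"
  obtains \<alpha> \<beta> where "\<And>z. H z = exp (\<alpha> + \<beta> * z)"
proof -
  obtain h where h: "h holomorphic_on UNIV" "\<And>z. exp (h z) = H z"
    using holomorphic_logarithm_exists[OF convex_UNIV open_UNIV H _ UNIV_I] nz by (metis UNIV_I)
  have "Re (h z) \<le> ln A + B * norm z" for z
  proof -
    have "exp (Re (h z)) \<le> exp (ln A + B * norm z)"
      using AB(1) AB(3)[of z] by (simp add: exp_add flip: h(2))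
    then show ?thesis by simp
  qed
  then obtain \<alpha> \<beta> where "\<And>z. h z = \<alpha> + \<beta> * z"
    using entire_affine_of_Re_growth[OF h(1) AB(2)] by blast
  then show ?thesis using h(2) that by metis
qed

section \<open>Adding and removing finitely many zeros\<close>

definition root_poly :: "complex multiset \<Rightarrow> complex \<Rightarrow> complex" where
  "root_poly \<nu> z = (\<Prod>b\<in>#\<nu>. z - b)"

lemma root_poly_simps [simp]:
  "root_poly {#} z = 1" "root_poly (add_mset b \<nu>) z = (z - b) * root_poly \<nu> z"
  by (simp_all add: root_poly_def)

lemma root_poly_holomorphic: "root_poly \<nu> holomorphic_on A"
proof -
  have "(\<lambda>z. root_poly \<nu> z) holomorphic_on A"
    by (induction \<nu>) (auto intro!: holomorphic_intros)
  then show ?thesis by simp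
qed

lemma root_poly_eq_0_iff: "root_poly \<nu> z = 0 \<longleftrightarrow> z \<in># \<nu>"
  by (induction \<nu>) auto

lemma root_poly_nonzero_somewhere: obtains b where "root_poly \<nu> b \<noteq> 0"
  using ex_new_if_finite[OF infinite_UNIV_char_0, of "set_mset \<nu>"] by (auto simp: root_poly_eq_0_iff)

lemma zorder_entire_mult:
  assumes f: "f holomorphic_on UNIV" "f b \<noteq> 0" and g: "g holomorphic_on UNIV" "g c \<noteq> 0"
  shows "zorder (\<lambda>z. f z * g z) z = zorder f z + zorder g z"
proof (rule zorder_times_analytic)
  show "f analytic_on {z}" "g analytic_on {z}"
    using f g by (meson analytic_on_holomorphic open_UNIV subset_UNIV)+
  show "\<forall>\<^sub>F w in at z. f w * g w \<noteq> 0"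
    using entire_eventually_nonzero[OF f] entire_eventually_nonzero[OF g]
    by eventually_elim simp
qed

lemma zorder_root_poly: "zorder (root_poly \<nu>) z = int (count \<nu> z)"
proof (induction \<nu>)
  case empty
  then show ?case by (simp add: root_poly_def)
next
  case (add b \<nu>)
  obtain c where c: "root_poly \<nu> c \<noteq> 0" by (rule root_poly_nonzero_somewhere)
  have lin: "zorder (\<lambda>w. w - b) z = (if z = b then 1 else 0)"
  proof (cases "z = b")
    case True
    then show ?thesis by (simp add: zorder_eqI[of UNIV b "\<lambda>_. 1" _ 1])
  next
    case False
    then show ?thesis by (auto intro!: zorder_eq_0I analytic_intros)
  qed
  have "zorder (\<lambda>w. (w - b) * root_poly \<nu> w) z = zorder (\<lambda>w. w - b) z + zorder (root_poly \<nu>) z"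
    by (rule zorder_entire_mult[of _ "b + 1" _ c]) (use c in \<open>auto intro!: holomorphic_intros root_poly_holomorphic\<close>)
  moreover have "root_poly (add_mset b \<nu>) = (\<lambda>w. (w - b) * root_poly \<nu> w)" by auto
  ultimately show ?case using add lin by simp
qed

lemma root_poly_growth:
  obtains R where "R \<ge> 1" "\<And>z::complex. norm z \<ge> R \<Longrightarrow> (norm z / 2) ^ size \<nu> \<le> norm (root_poly \<nu> z)"
    "\<And>z::complex. norm z \<ge> R \<Longrightarrow> norm (root_poly \<nu> z) \<le> (2 * norm z) ^ size \<nu>"
proof (induction \<nu> arbitrary: thesis)
  case empty
  show ?case by (rule empty[of 1]) auto
next
  case (add b \<nu>)
  obtain R where R: "R \<ge> 1" "\<And>z::complex. norm z \<ge> R \<Longrightarrow> (norm z / 2) ^ size \<nu> \<le> norm (root_poly \<nu> z)"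
    "\<And>z::complex. norm z \<ge> R \<Longrightarrow> norm (root_poly \<nu> z) \<le> (2 * norm z) ^ size \<nu>"
    using add.IH by blast
  show ?case
  proof (rule add.prems[of "max R (2 * norm b)"])
    show "max R (2 * norm b) \<ge> 1" using R by simp
    fix z :: complex assume z: "max R (2 * norm b) \<le> norm z"
    have "norm z / 2 \<le> norm (z - b)" using norm_triangle_ineq2[of z b] z by simp
    then show "(norm z / 2) ^ size (add_mset b \<nu>) \<le> norm (root_poly (add_mset b \<nu>) z)"
      unfolding root_poly_simps norm_mult size_add_mset power_Suc
      using R(2)[of z] z by (intro mult_mono) auto
    have "norm (z - b) \<le> 2 * norm z" using norm_triangle_ineq4[of z b] z norm_ge_zero[of b] by linarith
    then show "norm (root_poly (add_mset b \<nu>) z) \<le> (2 * norm z) ^ size (add_mset b \<nu>)"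
      unfolding root_poly_simps norm_mult size_add_mset power_Suc
      using R(3)[of z] z by (intro mult_mono) auto
  qed
qed

lemma divide_out_zeros:
  assumes "finite A" and f: "f holomorphic_on UNIV" and zero: "\<And>a. a \<in> A \<Longrightarrow> f a = 0"
  obtains g where "g holomorphic_on UNIV" "\<And>z. f z = g z * root_poly (mset_set A) z"
  using assms(1) zero
proof (induction A arbitrary: thesis)
  case empty
  show ?case by (rule empty(1)[OF f]) simp
next
  case (insert b A)
  obtain g where g: "g holomorphic_on UNIV" "\<And>z. f z = g z * root_poly (mset_set A) z"
    using insert.IH insert.prems(2) by blast
  have "g b = 0"
    using g(2)[of b] insert.prems(2)[of b] insert.hyps by (simp add: root_poly_eq_0_iff)
  define k where "k = (\<lambda>z. if z = b then deriv g b else (g z - g b) / (z - b))"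
  have "k holomorphic_on UNIV"
    unfolding k_def by (rule pole_lemma[OF g(1)]) simp
  moreover have "f z = k z * root_poly (mset_set (insert b A)) z" for z
    using insert.hyps g(2)[of z] \<open>g b = 0\<close> by (simp add: k_def)
  ultimately show ?case by (rule insert.prems(1))
qed

section \<open>Zero multisets from the slit sigma function\<close>

lemma fock_density_eq_square: "fock_density f z = (norm (f z) * gauss z)\<^sup>2"
  by (simp add: fock_density_def gauss_def power_mult_distrib flip: exp_double)

text \<open>
  Here \<open>g\<close> is the quotient of the slit sigma function by the polynomial with simple roots at the
  deleted points \<open>A\<close>, that is, the minimal function with zero multiset \<open>\<Lambda>\<close>. The functions with zero
  multiset \<open>\<Lambda> + \<nu>\<close> are then \<open>g * root_poly \<nu>\<close> times nonvanishing functions.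
\<close>

locale punctured_slit_sigma =
  fixes A :: "complex set" and g :: "complex \<Rightarrow> complex"
  assumes finite_A: "finite A" and A_subset: "A \<subseteq> square_lattice - vertical_line"
    and g_holomorphic: "g holomorphic_on UNIV"
    and factor: "\<And>z. slit_sigma z = g z * root_poly (mset_set A) z"
begin

abbreviation \<Lambda> :: "complex \<Rightarrow> nat" where
  "\<Lambda> \<equiv> indicator (square_lattice - (vertical_line \<union> A))"

lemma g_0: "g 0 \<noteq> 0"
  using slit_sigma_0 factor[of 0] by auto

lemma g_mult_root_poly_holomorphic: "(\<lambda>z. g z * root_poly \<nu> z) holomorphic_on UNIV"
  by (intro holomorphic_intros g_holomorphic root_poly_holomorphic)

lemma zorder_g: "zorder g z = int (\<Lambda> z)"
proof -
  obtain c where c: "root_poly (mset_set A) c \<noteq> 0" by (rule root_poly_nonzero_somewhere)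
  have "slit_sigma = (\<lambda>z. g z * root_poly (mset_set A) z)"
    using factor by auto
  then have "zorder slit_sigma z = zorder g z + int (count (mset_set A) z)"
    using zorder_entire_mult[OF g_holomorphic g_0 root_poly_holomorphic c] zorder_root_poly by simp
  moreover have "zorder slit_sigma z = (if z \<in> square_lattice - vertical_line then 1 else 0)"
  proof (cases "z \<in> square_lattice - vertical_line")
    case False
    have "slit_sigma analytic_on {z}"
      using slit_sigma_holomorphic by (meson analytic_on_holomorphic open_UNIV subset_UNIV)
    then show ?thesis using False zorder_eq_0I slit_sigma_eq_0_iff by auto
  qed (simp add: zorder_slit_sigma)
  moreover have "count (mset_set A) z = (if z \<in> A then 1 else 0)"
    using finite_A by (cases "z \<in> A") simp_all
  ultimately show ?thesis
    using A_subset by (auto simp: indicator_def split: if_splits)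
qed

lemma zorder_g_mult_root_poly: "zorder (\<lambda>z. g z * root_poly \<nu> z) z = int (\<Lambda> z + count \<nu> z)"
proof -
  obtain c where c: "root_poly \<nu> c \<noteq> 0" by (rule root_poly_nonzero_somewhere)
  show ?thesis
    using zorder_entire_mult[OF g_holomorphic g_0 root_poly_holomorphic c]
    by (simp add: zorder_g zorder_root_poly)
qed

text \<open>
  One power of \<open>\<bar>z\<bar>\<close> is gained as soon as fewer points are inserted than were deleted.
\<close>

lemma root_poly_quotient_decay:
  assumes "size \<nu> < card A"
  obtains R where "R \<ge> 1"
    "\<And>z. norm z \<ge> R \<Longrightarrow> norm (g z * root_poly \<nu> z) * norm z \<le> 4 ^ card A * norm (slit_sigma z)"
proof -
  let ?N = "card A"
  obtain R1 where R1: "R1 \<ge> 1" "\<And>z. norm z \<ge> R1 \<Longrightarrow> norm (root_poly \<nu> z) \<le> (2 * norm z) ^ size \<nu>"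
    using root_poly_growth[of \<nu>] by metis
  obtain R2 where R2: "\<And>z. norm z \<ge> R2 \<Longrightarrow> (norm z / 2) ^ ?N \<le> norm (root_poly (mset_set A) z)"
    using root_poly_growth[of "mset_set A"] by (metis size_mset_set)
  show ?thesis
  proof (rule that[of "max R1 R2"])
    fix z :: complex assume z: "max R1 R2 \<le> norm z"
    have z1: "norm z \<ge> 1" using z R1 by simp
    have "norm (root_poly \<nu> z) * norm z \<le> (2 * norm z) ^ size \<nu> * norm z"
      using R1 z by (intro mult_right_mono) auto
    also have "\<dots> = 2 ^ size \<nu> * norm z ^ (size \<nu> + 1)"
      by (simp add: power_mult_distrib)
    also have "\<dots> \<le> 2 ^ ?N * norm z ^ ?N"
      using assms z1 by (intro mult_mono power_increasing) auto
    also have "\<dots> = 4 ^ ?N * (norm z / 2) ^ ?N"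
      by (subst (1 2) power_mult_distrib [symmetric]) simp
    also have "\<dots> \<le> 4 ^ ?N * norm (root_poly (mset_set A) z)"
      using R2 z by (intro mult_left_mono) auto
    finally have "norm (g z) * (norm (root_poly \<nu> z) * norm z)
       \<le> norm (g z) * (4 ^ ?N * norm (root_poly (mset_set A) z))"
      by (intro mult_left_mono) auto
    then show "norm (g z * root_poly \<nu> z) * norm z \<le> 4 ^ card A * norm (slit_sigma z)"
      by (simp add: factor norm_mult mult_ac)
  qed (use R1 in auto)
qed

text \<open>
  Slit sigma decays like \<open>exp (- sqrt pi * \<bar>x\<bar>)\<close> with \<open>sqrt pi \<ge> 3/2\<close>, so after multiplication by
  \<open>exp (t z)\<close> there remains decay \<open>exp (- \<bar>x\<bar> / 2)\<close> in the horizontal direction. The integrability in the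
  vertical direction comes from the gained power of \<open>\<bar>z\<bar>\<close>.
\<close>

lemma fock_member:
  assumes size: "size \<nu> < card A" and t: "\<bar>t\<bar> \<le> 1"
  shows "(\<lambda>z. g z * root_poly \<nu> z * exp (of_real t * z)) \<in> fock"
proof -
  define f where "f = (\<lambda>z. g z * root_poly \<nu> z * exp (of_real t * z))"
  have f: "f holomorphic_on UNIV"
    unfolding f_def by (intro holomorphic_intros g_holomorphic root_poly_holomorphic)
  define D where "D = (\<lambda>z. fock_density f z * ((1 + (Re z)\<^sup>2) * (1 + (Im z)\<^sup>2)))"
  obtain R where R: "R \<ge> 1"
    "\<And>z. norm z \<ge> R \<Longrightarrow> norm (g z * root_poly \<nu> z) * norm z \<le> 4 ^ card A * norm (slit_sigma z)"
    by (rule root_poly_quotient_decay[OF size]) blast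
  obtain C where C: "C \<ge> 0" "\<And>z. norm (slit_sigma z) * gauss z \<le> C * exp (- sqrt pi * \<bar>Re z\<bar>)"
    by (rule weighted_slit_sigma_upper) blast
  define K where "K = 4 ^ card A * C"
  have K: "K \<ge> 0" using C by (simp add: K_def)
  have "sqrt pi \<ge> 3/2"
    using pi_gt3 by (intro real_le_rsqrt) (simp add: power2_eq_square)
  have far: "D z \<le> 4 * K\<^sup>2" if z: "norm z \<ge> R" for z
  proof -
    let ?x = "\<bar>Re z\<bar>"
    have z1: "norm z \<ge> 1" using R z by simp
    have "Re (of_real t * z) \<le> 1 * ?x"
      using mult_right_mono[OF t, of ?x] abs_ge_self[of "t * Re z"] by (simp add: abs_mult)
    then have "norm (exp (of_real t * z)) \<le> exp ?x" by simp
    have "norm (f z) * gauss z * norm z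
        = (norm (g z * root_poly \<nu> z) * norm z) * (gauss z * norm (exp (of_real t * z)))"
      by (simp add: f_def norm_mult mult_ac)
    also have "\<dots> \<le> (4 ^ card A * norm (slit_sigma z)) * (gauss z * exp ?x)"
      using \<open>norm (exp (of_real t * z)) \<le> exp ?x\<close>
      by (intro mult_mono[OF R(2)[OF z]] mult_left_mono) (auto simp: less_imp_le)
    also have "\<dots> = 4 ^ card A * (norm (slit_sigma z) * gauss z) * exp ?x"
      by (simp add: mult_ac)
    also have "\<dots> \<le> 4 ^ card A * (C * exp (- sqrt pi * ?x)) * exp ?x"
      by (intro mult_right_mono mult_left_mono C(2)) auto
    also have "\<dots> = K * exp (- sqrt pi * ?x + ?x)"
      unfolding K_def exp_add by (simp only: mult.assoc)
    also have "\<dots> \<le> K * exp (- (?x / 2))"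
      using mult_right_mono[OF \<open>sqrt pi \<ge> 3/2\<close>, of ?x] K by (intro mult_left_mono) auto
    finally have "(norm (f z) * gauss z * norm z)\<^sup>2 \<le> (K * exp (- (?x / 2)))\<^sup>2"
      by (intro power_mono) (auto simp: less_imp_le)
    then have "fock_density f z * (norm z)\<^sup>2 \<le> K\<^sup>2 * exp (- ?x)"
      by (simp add: fock_density_eq_square power_mult_distrib flip: exp_double)
    moreover have "1 + (Re z)\<^sup>2 \<le> 2 * exp ?x"
      using exp_lower_Taylor_quadratic[of ?x] by simp
    moreover have "1 + (Im z)\<^sup>2 \<le> 2 * (norm z)\<^sup>2"
    proof -
      have "1 \<le> (norm z)\<^sup>2" using z1 by simp
      moreover have "(Im z)\<^sup>2 \<le> (norm z)\<^sup>2" by (simp add: cmod_power2)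
      ultimately show ?thesis by linarith
    qed
    ultimately have "D z \<le> fock_density f z * ((2 * exp ?x) * (2 * (norm z)\<^sup>2))"
      unfolding D_def by (intro mult_left_mono mult_mono) auto
    also have "\<dots> = 4 * exp ?x * (fock_density f z * (norm z)\<^sup>2)" by simp
    also have "\<dots> \<le> 4 * exp ?x * (K\<^sup>2 * exp (- ?x))"
      using \<open>fock_density f z * (norm z)\<^sup>2 \<le> K\<^sup>2 * exp (- ?x)\<close> by (intro mult_left_mono) auto
    also have "\<dots> = 4 * K\<^sup>2" by (simp add: exp_minus)
    finally show ?thesis .
  qed
  have "compact (D ` cball 0 R)"
    unfolding D_def fock_density_def using holomorphic_on_imp_continuous_on[OF f]
    by (intro compact_continuous_image continuous_intros) (auto intro: continuous_on_subset)
  then obtain M where M: "\<And>z. z \<in> cball 0 R \<Longrightarrow> D z \<le> M"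
    by (meson bounded_imp_bdd_above compact_imp_bounded bdd_above.E imageI)
  have bound: "D z \<le> max M (4 * K\<^sup>2)" for z
    using far[of z] M[of z] by (cases "norm z \<ge> R") (auto simp: le_max_iff_disj)
  have "fock_density f z \<le> max M (4 * K\<^sup>2) / ((1 + (Re z)\<^sup>2) * (1 + (Im z)\<^sup>2))" for z
  proof -
    have "0 < (1 + (Re z)\<^sup>2) * (1 + (Im z)\<^sup>2)"
      by (intro mult_pos_pos add_pos_nonneg) auto
    then show ?thesis using bound[of z] by (simp add: D_def pos_le_divide_eq)
  qed
  then have "f \<in> fock" by (rule fockI_density_bound[OF f])
  then show ?thesis by (simp add: f_def)
qed

lemma eventually_nonzero: "\<forall>\<^sub>F w in at z. g w * root_poly \<nu> w \<noteq> 0"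
proof -
  obtain c where "root_poly \<nu> c \<noteq> 0" by (rule root_poly_nonzero_somewhere)
  then have "\<forall>\<^sub>F w in at z. root_poly \<nu> w \<noteq> 0"
    by (rule entire_eventually_nonzero[OF root_poly_holomorphic])
  with entire_eventually_nonzero[OF g_holomorphic g_0] show ?thesis
    by eventually_elim simp
qed

lemma exact_zero_mset_if_few:
  assumes "size \<nu> < card A"
  shows "exact_zero_mset (\<lambda>z. \<Lambda> z + count \<nu> z)"
  unfolding exact_zero_mset_def
proof (intro bexI conjI)
  let ?f = "\<lambda>z. g z * root_poly \<nu> z"
  show "?f \<in> fock" using fock_member[OF assms, of 0] by simp
  show "zero_mset ?f = (\<lambda>z. \<Lambda> z + count \<nu> z)"
    by (simp add: zero_mset_def zorder_g_mult_root_poly fun_eq_iff del: of_nat_add)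
  show "?f \<noteq> (\<lambda>_. 0)"
  proof
    assume "?f = (\<lambda>_. 0)"
    then show False
      using eventually_happens'[OF at_neq_bot eventually_nonzero[of \<nu> 0]] by (metis (lifting))
  qed
qed

lemma root_poly_quotient_lower:
  assumes "card A \<le> size \<nu>"
  obtains R where "R \<ge> 1"
    "\<And>z. norm z \<ge> R \<Longrightarrow> norm (slit_sigma z) \<le> 4 ^ size \<nu> * norm (g z * root_poly \<nu> z)"
proof -
  let ?N = "card A"
  obtain R1 where R1: "R1 \<ge> 1" "\<And>z. norm z \<ge> R1 \<Longrightarrow> (norm z / 2) ^ size \<nu> \<le> norm (root_poly \<nu> z)"
    using root_poly_growth[of \<nu>] by metis
  obtain R2 where R2: "\<And>z. norm z \<ge> R2 \<Longrightarrow> norm (root_poly (mset_set A) z) \<le> (2 * norm z) ^ ?N"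
    using root_poly_growth[of "mset_set A"] by (metis size_mset_set)
  show ?thesis
  proof (rule that[of "max R1 R2"])
    fix z :: complex assume z: "max R1 R2 \<le> norm z"
    have z1: "norm z \<ge> 1" using z R1 by simp
    have "norm (root_poly (mset_set A) z) \<le> (2 * norm z) ^ ?N"
      using R2 z by simp
    also have "\<dots> \<le> (2 * norm z) ^ size \<nu>"
      using assms z1 by (intro power_increasing) auto
    also have "\<dots> = 4 ^ size \<nu> * (norm z / 2) ^ size \<nu>"
      by (subst power_mult_distrib [symmetric]) simp
    also have "\<dots> \<le> 4 ^ size \<nu> * norm (root_poly \<nu> z)"
      using R1 z by (intro mult_left_mono) auto
    finally have "norm (g z) * norm (root_poly (mset_set A) z)
       \<le> norm (g z) * (4 ^ size \<nu> * norm (root_poly \<nu> z))"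
      by (intro mult_left_mono) auto
    then show "norm (slit_sigma z) \<le> 4 ^ size \<nu> * norm (g z * root_poly \<nu> z)"
      by (simp add: factor norm_mult mult_ac)
  qed (use R1 in auto)
qed

text \<open>
  The size of \<open>\<nu>\<close> enters only through the fact that the candidate \<open>g * root_poly \<nu>\<close> is not smaller than
  slit sigma at infinity. This serves twice: it bounds the quotient \<open>H\<close> from above on the grid, and
  once \<open>H\<close> is known to be \<open>exp (\<alpha> + \<beta> z)\<close>, it keeps the product away from zero along a vertical sequence.
\<close>

lemma not_exact_zero_mset_if_many:
  assumes size: "card A \<le> size \<nu>"
  shows "\<not> exact_zero_mset (\<lambda>z. \<Lambda> z + count \<nu> z)"
proof
  assume "exact_zero_mset (\<lambda>z. \<Lambda> z + count \<nu> z)"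
  then obtain f where f: "f \<in> fock" "f \<noteq> (\<lambda>_. 0)" and zm: "zero_mset f = (\<lambda>z. \<Lambda> z + count \<nu> z)"
    by (auto simp: exact_zero_mset_def)
  have hf: "f holomorphic_on UNIV" using f by (simp add: fock_def)
  obtain b where b: "f b \<noteq> 0" using f(2) by auto
  define k where "k = (\<lambda>z. g z * root_poly \<nu> z)"
  have hk: "k holomorphic_on UNIV" unfolding k_def by (rule g_mult_root_poly_holomorphic)
  have an: "F analytic_on {z}" if "F holomorphic_on UNIV" for F z
    using that by (meson analytic_on_holomorphic open_UNIV subset_UNIV)
  have freq_f: "\<exists>\<^sub>F w in at z. f w \<noteq> 0" for z
    using entire_eventually_nonzero[OF hf b] by (simp add: eventually_frequently)
  have freq_k: "\<exists>\<^sub>F w in at z. k w \<noteq> 0" for z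
    using eventually_nonzero[of \<nu> z] unfolding k_def by (simp add: eventually_frequently)
  have zo: "zorder f z = zorder k z" for z
  proof -
    have "zorder f z \<ge> 0" by (rule zorder_ge_0[OF an[OF hf] freq_f])
    moreover have "nat (zorder f z) = \<Lambda> z + count \<nu> z"
      using fun_cong[OF zm, of z] by (simp add: zero_mset_def)
    ultimately show ?thesis unfolding k_def zorder_g_mult_root_poly by linarith
  qed
  have "k z = 0 \<longleftrightarrow> f z = 0" for z
    using zorder_pos_iff'[OF an[OF hf] freq_f, of z] zorder_pos_iff'[OF an[OF hk] freq_k, of z] zo[of z]
    by simp
  then obtain H where H: "H holomorphic_on UNIV" "\<And>z. H z \<noteq> 0" "\<And>z. f z = H z * k z"
    using holomorphic_zorder_factorization[OF hf open_UNIV connected_UNIV hk] zo by (metis UNIV_I)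
  obtain R where R: "R \<ge> 1" "\<And>z. norm z \<ge> R \<Longrightarrow> norm (slit_sigma z) \<le> 4 ^ size \<nu> * norm (k z)"
    unfolding k_def by (rule root_poly_quotient_lower[OF size]) blast
  obtain c where c: "c > 0"
    "\<And>z. z \<in> half_grid \<Longrightarrow> c * exp (- sqrt pi * \<bar>Re z\<bar>) \<le> norm (slit_sigma z) * gauss z"
    by (rule weighted_slit_sigma_half_grid_lower) blast
  have lower: "norm (H z) * (c * exp (- sqrt pi * \<bar>Re z\<bar>)) \<le> 4 ^ size \<nu> * (norm (f z) * gauss z)"
    if z: "z \<in> half_grid" "norm z \<ge> R" for z
  proof -
    have "c * exp (- sqrt pi * \<bar>Re z\<bar>) \<le> norm (slit_sigma z) * gauss z" by (rule c(2)[OF z(1)])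
    also have "\<dots> \<le> 4 ^ size \<nu> * norm (k z) * gauss z"
      using R(2)[OF z(2)] by (intro mult_right_mono) (auto simp: less_imp_le)
    finally have "norm (H z) * (c * exp (- sqrt pi * \<bar>Re z\<bar>)) \<le> norm (H z) * (4 ^ size \<nu> * norm (k z) * gauss z)"
      by (rule mult_left_mono) simp
    then show ?thesis by (simp add: H(3) norm_mult mult_ac)
  qed
  obtain M where M: "M \<ge> 0" "\<And>z. fock_density f z \<le> M"
    by (rule fock_density_bounded[OF f(1)]) blast
  have upper: "norm (f z) * gauss z \<le> sqrt M" for z
    using M(2)[of z] unfolding fock_density_eq_square by (rule real_le_rsqrt)
  have "norm (H z) \<le> (4 ^ size \<nu> * sqrt M / c) * exp (sqrt pi * \<bar>Re z\<bar>)"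
    if z: "z \<in> half_grid" "norm z \<ge> R" for z
  proof -
    have "norm (H z) * (c * exp (- sqrt pi * \<bar>Re z\<bar>)) \<le> 4 ^ size \<nu> * sqrt M"
      by (rule order_trans[OF lower[OF z]]) (intro mult_left_mono upper; simp)
    then show ?thesis
      using c(1) by (simp add: exp_minus field_simps)
  qed
  then obtain B where "B > 0" "\<And>z. norm (H z) \<le> B * exp (sqrt pi * norm z)"
    using half_grid_growth_imp_exponential_type[OF H(1)] by metis
  then obtain \<alpha> \<beta> where exp_form: "\<And>z. H z = exp (\<alpha> + \<beta> * z)"
    using nonvanishing_exponential_type[OF H(1,2), of B "sqrt pi"] by auto
  \<comment> \<open>The vertical direction in which \<open>\<bar>exp (\<beta> z)\<bar>\<close> does not decay.\<close>
  define \<epsilon> :: real where "\<epsilon> = (if Im \<beta> \<le> 0 then 1 else -1)"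
  \<comment> \<open>Real part \<open>sqrt pi / 2\<close> puts the whole sequence on one line of the grid.\<close>
  define p where "p = (\<lambda>n::nat. Complex (sqrt pi / 2) (\<epsilon> * real n))"
  have p_grid: "p n \<in> half_grid" for n
    by (auto simp: p_def half_grid_def intro!: exI[of _ 0])
  have p_norm: "norm (p n) \<ge> real n" for n
    using abs_Im_le_cmod[of "p n"] by (simp add: p_def \<epsilon>_def split: if_splits)
  then have p_inf: "filterlim p at_infinity sequentially"
    by (intro filterlim_norm_at_top_imp_at_infinity filterlim_at_top_mono[OF filterlim_real_sequentially]) auto
  define d where "d = exp (Re \<alpha> + Re \<beta> * (sqrt pi / 2)) * (c * exp (- sqrt pi * (sqrt pi / 2)))"
  have "d > 0" using c(1) by (simp add: d_def)
  have d_le: "d \<le> 4 ^ size \<nu> * (norm (f (p n)) * gauss (p n))" if "real n \<ge> R" for n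
  proof -
    have "Im \<beta> * (\<epsilon> * real n) \<le> 0"
      by (auto simp: \<epsilon>_def mult_nonpos_nonneg)
    moreover have "Re (\<alpha> + \<beta> * p n) = Re \<alpha> + Re \<beta> * (sqrt pi / 2) - Im \<beta> * (\<epsilon> * real n)"
      by (simp add: p_def)
    ultimately have "exp (Re \<alpha> + Re \<beta> * (sqrt pi / 2)) \<le> norm (H (p n))"
      by (simp only: exp_form norm_exp_eq_Re exp_le_cancel_iff)
    then have "d \<le> norm (H (p n)) * (c * exp (- sqrt pi * \<bar>Re (p n)\<bar>))"
      unfolding d_def using c(1) by (intro mult_mono) (auto simp: p_def)
    also have "\<dots> \<le> 4 ^ size \<nu> * (norm (f (p n)) * gauss (p n))"
      using that p_norm[of n] by (intro lower p_grid) simp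
    finally show ?thesis .
  qed
  have "(\<lambda>n. fock_density f (p n)) \<longlonglongrightarrow> 0"
    by (rule fock_density_tendsto_0[OF f(1) p_inf])
  then have "(\<lambda>n. sqrt (fock_density f (p n))) \<longlonglongrightarrow> sqrt 0"
    by (rule tendsto_real_sqrt)
  then have "(\<lambda>n. norm (f (p n)) * gauss (p n)) \<longlonglongrightarrow> 0"
    by (simp add: fock_density_eq_square abs_mult less_imp_le)
  then have "(\<lambda>n. 4 ^ size \<nu> * (norm (f (p n)) * gauss (p n))) \<longlonglongrightarrow> 4 ^ size \<nu> * 0"
    by (intro tendsto_mult tendsto_const)
  then have "(\<lambda>n. 4 ^ size \<nu> * (norm (f (p n)) * gauss (p n))) \<longlonglongrightarrow> 0" by simp
  moreover have "\<forall>\<^sub>F n in sequentially. d \<le> 4 ^ size \<nu> * (norm (f (p n)) * gauss (p n))"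
    using eventually_ge_at_top[of "nat \<lceil>R\<rceil>"] by eventually_elim (rule d_le, linarith)
  ultimately have "d \<le> 0"
    by (intro tendsto_lowerbound[of _ 0 sequentially]) auto
  then show False using \<open>d > 0\<close> by simp
qed

lemma insertion_index_eq:
  assumes "card A = Suc m"
  shows "insertion_index \<Lambda> = enat m"
proof -
  have "(\<forall>\<nu> :: complex multiset. size \<nu> = q \<longrightarrow> exact_zero_mset (\<lambda>z. \<Lambda> z + count \<nu> z)) \<longleftrightarrow> q \<le> m" for q
  proof
    assume *: "\<forall>\<nu> :: complex multiset. size \<nu> = q \<longrightarrow> exact_zero_mset (\<lambda>z. \<Lambda> z + count \<nu> z)"
    have "exact_zero_mset (\<lambda>z. \<Lambda> z + count (replicate_mset q 0) z)"
      using *[rule_format, of "replicate_mset q 0"] by simp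
    then have "\<not> card A \<le> size (replicate_mset q (0::complex))"
      using not_exact_zero_mset_if_many by blast
    then show "q \<le> m" using assms by simp
  qed (use exact_zero_mset_if_few assms in auto)
  then have "insertion_index \<Lambda> = Sup {enat q | q. q \<le> m}"
    unfolding insertion_index_def by simp
  also have "\<dots> = enat m"
    by (rule antisym) (auto intro!: Sup_least Sup_upper)
  finally show ?thesis .
qed

lemma vanishing_space_member:
  assumes "A \<noteq> {}" "\<bar>t\<bar> \<le> 1"
  shows "(\<lambda>z. g z * exp (of_real t * z)) \<in> vanishing_space \<Lambda>"
proof -
  have "(\<lambda>z. g z * root_poly {#} z * exp (of_real t * z)) \<in> fock"
    using assms finite_A by (intro fock_member) (simp_all add: card_gt_0_iff)
  moreover have "g z = 0" if "z \<in> square_lattice" "z \<notin> vertical_line" "z \<notin> A" for z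
    using that factor[of z] finite_A slit_sigma_eq_0_iff[of z] by (auto simp: root_poly_eq_0_iff)
  ultimately show ?thesis
    by (auto simp: vanishing_space_def indicator_def)
qed

text \<open>
  The functions \<open>g * exp (k z / n)\<close> with \<open>k < n\<close> all lie in the vanishing space. A linear relation
  between them is a polynomial relation for \<open>exp (z / n)\<close> at all points where \<open>g\<close> does not vanish, in particular
  at infinitely many real points, hence trivial. Taking \<open>n\<close> larger than the size of a finite
  spanning set gives a contradiction.
\<close>

lemma vanishing_space_infinite_dimensional:
  assumes "A \<noteq> {}"
  shows "cdimension (vanishing_space \<Lambda>) = \<infinity>"
proof (rule ccontr)
  assume "cdimension (vanishing_space \<Lambda>) \<noteq> \<infinity>"
  then obtain B where B: "finite B" "vanishing_space \<Lambda> \<subseteq> cfun.span B"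
    by (auto simp: cdimension_def split: if_splits)
  define n where "n = card B + 1"
  define F where "F = (\<lambda>k::nat. \<lambda>z. g z * exp (of_real (real k / real n) * z))"
  have n: "n > 0" by (simp add: n_def)
  have sub: "F ` {..<n} \<subseteq> vanishing_space \<Lambda>"
  proof (rule image_subsetI)
    fix k assume "k \<in> {..<n}"
    then have "\<bar>real k / real n\<bar> \<le> 1" by simp
    then show "F k \<in> vanishing_space \<Lambda>"
      unfolding F_def by (rule vanishing_space_member[OF assms])
  qed
  have zero_coeffs: "\<forall>k<n. a k = 0" if rel: "\<And>z. (\<Sum>k<n. a k * F k z) = 0" for a :: "nat \<Rightarrow> complex"
  proof -
    define p where "p = (\<Sum>k<n. monom (a k) k)"
    let ?e = "\<lambda>x::real. exp (complex_of_real (x / real n))"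
    have root: "poly p (?e x) = 0" if x: "0 < x" "x < 1" for x
    proof -
      have "of_real x \<notin> square_lattice - vertical_line"
      proof
        assume "of_real x \<in> square_lattice - vertical_line"
        then obtain i j :: int where "of_real x = \<omega> * (of_int i + \<i> * of_int j)" "i \<noteq> 0"
          unfolding slit_lattice_iff by blast
        then have "Re (of_real x) = Re (\<omega> * (of_int i + \<i> * of_int j))" by simp
        then have "x = sqrt pi * of_int i" by simp
        moreover have "sqrt pi > 1" using pi_gt3 by simp
        moreover have "i \<ge> 1" using calculation x by (simp add: zero_less_mult_iff)
        then have "sqrt pi * 1 \<le> sqrt pi * of_int i" by (intro mult_left_mono) auto
        ultimately show False using x by linarith
      qed
      then have "g (of_real x) \<noteq> 0"
        using factor[of "of_real x"] slit_sigma_eq_0_iff[of "of_real x"] by auto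
      moreover have "F k (of_real x) = g (of_real x) * ?e x ^ k" for k
        by (simp add: F_def flip: exp_of_nat_mult)
      then have "(\<Sum>k<n. a k * F k (of_real x)) = g (of_real x) * (\<Sum>k<n. a k * ?e x ^ k)"
        by (simp add: sum_distrib_left mult_ac)
      moreover have "poly p (?e x) = (\<Sum>k<n. a k * ?e x ^ k)"
        by (simp add: p_def poly_sum poly_monom)
      ultimately show ?thesis using rel[of "of_real x"] by simp
    qed
    have "p = 0"
    proof (rule ccontr)
      assume "p \<noteq> 0"
      then have "finite {z. poly p z = 0}" by (rule poly_roots_finite)
      then have "finite (?e ` {0<..<1})"
        by (rule finite_subset[rotated]) (use root in auto)
      moreover have "inj_on ?e {0<..<1}"
        unfolding exp_of_real inj_on_def using n by auto
      ultimately have "finite {0<..<1::real}" by (simp add: finite_image_iff)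
      then show False using infinite_Ioo[of 0 "1::real"] by simp
    qed
    have "coeff p k = a k" if "k < n" for k
      using that by (simp add: p_def coeff_sum sum.delta)
    then show ?thesis using \<open>p = 0\<close> by simp
  qed
  have inj: "inj_on F {..<n}"
  proof (rule inj_onI)
    fix i j assume ij: "i \<in> {..<n}" "j \<in> {..<n}" "F i = F j"
    show "i = j"
    proof (rule ccontr)
      assume "i \<noteq> j"
      let ?a = "\<lambda>k. (if k = i then 1 else 0) - (if k = j then 1 else 0 :: complex)"
      have "(\<Sum>k<n. ?a k * F k z) = 0" for z
        using ij by (simp add: left_diff_distrib sum_subtractf if_distrib[of "\<lambda>x. x * _"] sum.delta cong: if_cong)
      from zero_coeffs[OF this] have "?a i = 0" using ij by blast
      then show False using \<open>i \<noteq> j\<close> by simp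
    qed
  qed
  have indep: "cfun.independent (F ` {..<n})"
  proof
    assume "cfun.dependent (F ` {..<n})"
    then obtain u where u: "\<exists>v\<in>F ` {..<n}. u v \<noteq> 0" "(\<Sum>v\<in>F ` {..<n}. scale_fun (u v) v) = 0"
      by (auto simp: cfun.dependent_finite)
    have "(\<Sum>k<n. u (F k) * F k z) = 0" for z
    proof -
      have "(\<Sum>v\<in>F ` {..<n}. scale_fun (u v) v) z = (\<Sum>v\<in>F ` {..<n}. u v * v z)"
        by (induction rule: infinite_finite_induct) (auto simp: scale_fun_def)
      also have "\<dots> = (\<Sum>k<n. u (F k) * F k z)"
        by (simp add: sum.reindex[OF inj])
      finally show ?thesis using u(2) by simp
    qed
    from zero_coeffs[OF this] show False using u(1) by auto
  qed
  have "card (F ` {..<n}) \<le> card B"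
    using cfun.independent_span_bound[OF B(1) indep] sub B(2) by auto
  then show False unfolding card_image[OF inj] by (simp add: n_def)
qed

end

lemma deleted_lattice_properties:
  assumes "finite A" "A \<subseteq> square_lattice - vertical_line" "card A = Suc m"
  defines "\<Lambda> \<equiv> indicator (square_lattice - (vertical_line \<union> A)) :: complex \<Rightarrow> nat"
  shows "exact_zero_mset \<Lambda>" "cdimension (vanishing_space \<Lambda>) = \<infinity>" "insertion_index \<Lambda> = enat m"
    "simple_mset \<Lambda>"
proof -
  have "\<And>a. a \<in> A \<Longrightarrow> slit_sigma a = 0" using assms(2) slit_sigma_eq_0_iff by blast
  then obtain g where g: "g holomorphic_on UNIV" "\<And>z. slit_sigma z = g z * root_poly (mset_set A) z"
    using divide_out_zeros[OF assms(1) slit_sigma_holomorphic] by blast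
  interpret punctured_slit_sigma A g
    by unfold_locales (use assms g in auto)
  show "exact_zero_mset \<Lambda>"
    using exact_zero_mset_if_few[of "{#}"] assms(3) by (simp add: \<Lambda>_def)
  show "cdimension (vanishing_space \<Lambda>) = \<infinity>"
    unfolding \<Lambda>_def using assms(3) by (intro vanishing_space_infinite_dimensional) auto
  show "insertion_index \<Lambda> = enat m"
    unfolding \<Lambda>_def by (rule insertion_index_eq[OF assms(3)])
  show "simple_mset \<Lambda>" by (simp add: simple_mset_def \<Lambda>_def indicator_def)
qed

theorem theoremB:
  "(\<forall>m::nat. \<exists>\<Lambda>.
      simple_mset \<Lambda> \<and> exact_zero_mset \<Lambda> \<and>
      cdimension (vanishing_space \<Lambda>) = \<infinity> \<and> insertion_index \<Lambda> = enat m) \<and>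
   (\<forall>(m::nat) (a :: nat \<Rightarrow> complex) \<Lambda>.
      inj_on a {1..m + 1} \<and> a ` {1..m + 1} \<subseteq> square_lattice - vertical_line \<and>
      \<Lambda> = indicator (square_lattice - (vertical_line \<union> a ` {1..m + 1})) \<longrightarrow>
      simple_mset \<Lambda> \<and> exact_zero_mset \<Lambda> \<and>
      cdimension (vanishing_space \<Lambda>) = \<infinity> \<and> insertion_index \<Lambda> = enat m) \<and>
   (\<forall>a \<Lambda>.
      a \<in> square_lattice - vertical_line \<and>
      \<Lambda> = indicator (square_lattice - (vertical_line \<union> {a})) \<longrightarrow>
      exact_zero_mset \<Lambda> \<and> maximal_under_finite_additions \<Lambda> \<and>
      cdimension (vanishing_space \<Lambda>) = \<infinity>)"
proof (intro conjI allI impI)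
  fix m :: nat and a :: "nat \<Rightarrow> complex" and \<Lambda> :: "complex \<Rightarrow> nat"
  assume *: "inj_on a {1..m + 1} \<and> a ` {1..m + 1} \<subseteq> square_lattice - vertical_line \<and>
      \<Lambda> = indicator (square_lattice - (vertical_line \<union> a ` {1..m + 1}))"
  have "card (a ` {1..m + 1}) = Suc m" using * by (subst card_image) auto
  then show "simple_mset \<Lambda>" "exact_zero_mset \<Lambda>"
      "cdimension (vanishing_space \<Lambda>) = \<infinity>" "insertion_index \<Lambda> = enat m"
    using deleted_lattice_properties[of "a ` {1..m + 1}" m] * by auto
next
  fix a :: complex and \<Lambda> :: "complex \<Rightarrow> nat"
  assume *: "a \<in> square_lattice - vertical_line \<and>
      \<Lambda> = indicator (square_lattice - (vertical_line \<union> {a}))"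
  then show "exact_zero_mset \<Lambda>" "cdimension (vanishing_space \<Lambda>) = \<infinity>"
    using deleted_lattice_properties[of "{a}" 0] by auto
  show "maximal_under_finite_additions \<Lambda>"
    using deleted_lattice_properties[of "{a}" 0] * 
    by (auto simp: maximal_under_finite_additions_def zero_enat_def)
next
  fix m :: nat
  \<comment> \<open>Any distinct points off the vertical line will do, for instance those on the positive real axis.\<close>
  define a where "a = (\<lambda>j::nat. \<omega> * (of_int (int j) + \<i> * of_int 0))"
  have "inj_on a {1..m + 1}" by (auto simp: inj_on_def a_def)
  then have "card (a ` {1..m + 1}) = Suc m" by (subst card_image) auto
  moreover have "a ` {1..m + 1} \<subseteq> square_lattice - vertical_line"
  proof
    fix z assume "z \<in> a ` {1..m + 1}"
    then obtain j where "j \<ge> 1" "z = \<omega> * (of_int (int j) + \<i> * of_int 0)"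
      by (auto simp: a_def)
    then have "int j \<noteq> 0 \<and> z = \<omega> * (of_int (int j) + \<i> * of_int 0)" by simp
    then show "z \<in> square_lattice - vertical_line" unfolding slit_lattice_iff by blast
  qed
  ultimately show "\<exists>\<Lambda>. simple_mset \<Lambda> \<and> exact_zero_mset \<Lambda> \<and>
      cdimension (vanishing_space \<Lambda>) = \<infinity> \<and> insertion_index \<Lambda> = enat m"
    using deleted_lattice_properties[of "a ` {1..m + 1}" m] by blast
qed

end
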